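(* Let $M$ be a von Neumann algebra with a faithful normal state $\varphi$, let $n\ge1$, let $X=(x_1,\dots,x_n)\in M^n$ be an $n$-tuple of self-adjoint elements and let $V\in\mathcal{P}=\mathbb{C}\langle t_1,\dots,t_n\rangle$. Assume that $\varphi([\mathcal{D}_iV](X))=0$ for $i=1,\dots,n$. Then there exists a free Stein kernel $A$ for $X$ relative to $V$, which moreover satisfies $$\Sigma^*(X|V)^2\le\|A-(1\otimes1^{op})\otimes I_n\|^2_{(\varphi\otimes\varphi^{op})\circ \mathrm{Tr}}\le n+C_{opt}(X)\|[\mathcal{D}V](X)\|_2^2-2\,\mathrm{Re}\,\langle[\mathcal{D}V](X),X\rangle_\varphi.$$ In particular, if $X$ is centered ($\varphi(x_i)=0$ for all $i$) and satisfies $\sum_{i=1}^n\varphi(x_i^2)=n$, then $$\Sigma^*\Big(X\,\Big|\,\tfrac12\sum_{i=1}^nt_i^2\Big)^2\le n(C_{opt}(X)-1).$$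
   Context: $\mathcal{P}=\mathbb{C}\langle t_1,\dots,t_n\rangle$ is the algebra of noncommutative polynomials, with antilinear involution determined by $(PQ)^*=Q^*P^*$, $t_i^*=t_i$. The noncommutative derivatives $\partial_i:\mathcal{P}\to\mathcal{P}\otimes\mathcal{P}$ are the unique linear maps with $\partial_i(t_j)=\delta_{ij}\,1\otimes 1$ and $\partial_i(PQ)=\partial_i(P)\cdot Q+P\cdot\partial_i(Q)$, where $P_1\cdot(Q_1\otimes Q_2)\cdot P_2=(P_1Q_1)\otimes(Q_2P_2)$. The cyclic derivatives are $\mathcal{D}_i=m\circ\sigma\circ\partial_i$ with $\sigma(P\otimes Q)=Q\otimes P$, $m(P\otimes Q)=PQ$; the cyclic gradient of $V$ is $\mathcal{D}V=(\mathcal{D}_1V,\dots,\mathcal{D}_nV)$. For $P=(P_1,\dots,P_n)\in\mathcal{P}^n$ the Jacobian matrix is $\mathcal{J}P=(\partial_jP_i)_{i,j=1}^n\in M_n(\mathcal{P}\otimes\mathcal{P})$. Evaluation at $X$: $P(X)\in M$ is obtained by substituting $t_i\mapsto x_i$; elements of $\mathcal{P}\otimes\mathcal{P}$ are evaluated in each leg and viewed in $M\otimes M^{op}$ ($M^{op}$ is $M$ with opposite multiplication, $\varphi^{op}$ is $\varphi$ viewed as a state on $M^{op}$); tuples and matrices are evaluated entrywise. Inner products: $\langle X,Y\rangle_\varphi=\sum_{i=1}^n\varphi(x_iy_i^* )$ on $M^n$, and $\langle A,B\rangle_{(\varphi\otimes\varphi^{op})\circ \mathrm{Tr}}=\sum_{i,j}(\varphi\otimes\varphi^{op})(a_{i,j}\cdot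 b_{i,j}^* )$ for matrices over $M\otimes M^{op}$, where $(a\otimes b)^*=a^*\otimes b^*$. The space $L^2(M_n(M\bar\otimes M^{op}),(\varphi\otimes\varphi^{op})\circ \mathrm{Tr})$ is the Hilbert space completion for the latter, with norm $\|\cdot\|_{(\varphi\otimes\varphi^{op})\circ \mathrm{Tr}}$. $\|\cdot\|_2$ denotes the $L^2$-norms associated with $\varphi$ (on $M$ or $M^n$) or with $\varphi\otimes\varphi^{op}$. A free Stein kernel for $X$ relative to $V\in\mathcal{P}$ is an $A$ in this $L^2$-space with $\langle[\mathcal{D}V](X),P(X)\rangle_\varphi=\langle A,[\mathcal{J}P](X)\rangle_{(\varphi\otimes\varphi^{op})\circ \mathrm{Tr}}$ for all $P\in\mathcal{P}^n$. The free Stein discrepancy is $\Sigma^*(X|V)=\inf_A\|A-(1\otimes1^{op})\otimes I_n\|_{(\varphi\otimes\varphi^{op})\circ \mathrm{Tr}}$, the infimum being over all free Stein kernels $A$ of $X$ relative to $V$; $(1\otimes1^{op})\otimes I_n$ is the diagonal matrix with entries $1\otimes1^{op}$. $X$ satisfies a free Poincaré inequality with constant $c$ if $\|P(X)-\varphi(P(X))\|_2^2\le c\sum_{i=1}^n\|[\partial_iP](X)\|_2^2$ for all $P\in\mathcal{P}$; $C_{opt}(X)$ is the best (smallest) such constant. *)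

theory Defs
  imports "HOL-Analysis.Analysis" "HOL-Library.Poly_Mapping"
begin

section \<open>Complex vector spaces and complex Hilbert spaces\<close>

class complex_vector = ab_group_add +
  fixes scaleC :: "complex \<Rightarrow> 'a \<Rightarrow> 'a" (infixr \<open>*\<^sub>C\<close> 75)
  assumes scaleC_add_right: "c *\<^sub>C (x + y) = c *\<^sub>C x + c *\<^sub>C y"
    and scaleC_add_left: "(c + d) *\<^sub>C x = c *\<^sub>C x + d *\<^sub>C x"
    and scaleC_scaleC: "c *\<^sub>C (d *\<^sub>C x) = (c * d) *\<^sub>C x"
    and scaleC_one: "1 *\<^sub>C x = x"
begin

lemma scaleC_zero_right [simp]: "c *\<^sub>C 0 = 0"
  using scaleC_add_right[of c 0 0] by simp

lemma scaleC_zero_left [simp]: "0 *\<^sub>C x = 0"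
  using scaleC_add_left[of 0 0 x] by simp

lemma scaleC_minus_left: "(- c) *\<^sub>C x = - (c *\<^sub>C x)"
  using scaleC_add_left[of "- c" c x] by (simp add: eq_neg_iff_add_eq_0)

lemma scaleC_minus_right: "c *\<^sub>C (- x) = - (c *\<^sub>C x)"
  using scaleC_add_right[of c "- x" x] by (simp add: eq_neg_iff_add_eq_0)

lemma scaleC_diff_right: "c *\<^sub>C (x - y) = c *\<^sub>C x - c *\<^sub>C y"
  using scaleC_add_right[of c "x - y" y] by simp

end

lemma scaleC_sum_right: "c *\<^sub>C (\<Sum>x\<in>A. f x) = (\<Sum>x\<in>A. c *\<^sub>C f x)"
  for f :: "'b \<Rightarrow> 'a::complex_vector"
  by (induction A rule: infinite_finite_induct) (simp_all add: scaleC_add_right)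

text \<open>\<open>cinner\<close> is linear in the first and antilinear in the second argument.\<close>

class chilbert_space = real_inner + complete_space + complex_vector +
  fixes cinner :: "'a \<Rightarrow> 'a \<Rightarrow> complex"
  assumes scaleR_scaleC: "r *\<^sub>R x = complex_of_real r *\<^sub>C x"
    and cinner_commute: "cinner x y = cnj (cinner y x)"
    and cinner_add_left: "cinner (x + y) z = cinner x z + cinner y z"
    and cinner_scaleC_left: "cinner (c *\<^sub>C x) y = c * cinner x y"
    and Re_cinner: "Re (cinner x y) = inner x y"

instantiation complex :: chilbert_space
begin
definition scaleC_complex_def: "scaleC c (x::complex) = c * x"
definition cinner_complex_def: "cinner x (y::complex) = x * cnj y"
instance
  by standard (simp_all add: scaleC_complex_def cinner_complex_def inner_complex_def
      algebra_simps scaleR_conv_of_real)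
end

section \<open>Bounded operators and von Neumann algebras\<close>

typedef (overloaded) 'h bop =
  "{f :: 'h::chilbert_space \<Rightarrow> 'h. bounded_linear f \<and> (\<forall>c x. f (c *\<^sub>C x) = c *\<^sub>C f x)}"
  morphisms bop_apply Abs_bop
  by (rule exI[of _ "\<lambda>x. x"]) (simp add: bounded_linear_ident)

setup_lifting type_definition_bop

lemma bop_eqI: "(\<And>x. bop_apply a x = bop_apply b x) \<Longrightarrow> a = b"
  by transfer auto

lemma bounded_linear_scaleC: "bounded_linear (\<lambda>x::'h::chilbert_space. c *\<^sub>C x)"
proof (rule bounded_linear_intro)
  fix x y :: 'h and r :: real
  show "c *\<^sub>C (x + y) = c *\<^sub>C x + c *\<^sub>C y" by (rule scaleC_add_right)
  show "c *\<^sub>C (r *\<^sub>R x) = r *\<^sub>R (c *\<^sub>C x)"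
    by (simp add: scaleR_scaleC scaleC_scaleC mult.commute)
  have "inner (c *\<^sub>C x) (c *\<^sub>C x) = Re (cinner (c *\<^sub>C x) (c *\<^sub>C x))" by (simp add: Re_cinner)
  also have "cinner (c *\<^sub>C x) (c *\<^sub>C x) = c * cnj c * cinner x x"
    by (metis (no_types, lifting) cinner_commute cinner_scaleC_left complex_cnj_mult mult.assoc)
  also have "\<dots> = complex_of_real ((cmod c)\<^sup>2) * cinner x x"
    by (metis complex_norm_square of_real_power)
  also have "Re \<dots> = (cmod c)\<^sup>2 * inner x x"
    by (simp add: Re_cinner)
  finally have "(norm (c *\<^sub>C x))\<^sup>2 = (norm x * cmod c)\<^sup>2"
    by (simp add: power2_norm_eq_inner power_mult_distrib mult.commute)
  then have "norm (c *\<^sub>C x) = norm x * cmod c"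
    by (simp add: power2_eq_iff_nonneg)
  then show "norm (c *\<^sub>C x) \<le> norm x * cmod c" by simp
qed

instantiation bop :: (chilbert_space) "{ring, monoid_mult, complex_vector}"
begin

lift_definition zero_bop :: "'a bop" is "\<lambda>_. 0" by simp
lift_definition one_bop :: "'a bop" is "\<lambda>x. x" by (simp add: bounded_linear_ident)
lift_definition plus_bop :: "'a bop \<Rightarrow> 'a bop \<Rightarrow> 'a bop" is "\<lambda>f g x. f x + g x"
  by (simp add: bounded_linear_add scaleC_add_right)
lift_definition minus_bop :: "'a bop \<Rightarrow> 'a bop \<Rightarrow> 'a bop" is "\<lambda>f g x. f x - g x"
  by (auto simp: scaleC_diff_right intro: bounded_linear_sub)
lift_definition uminus_bop :: "'a bop \<Rightarrow> 'a bop" is "\<lambda>f x. - f x"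
  by (simp add: bounded_linear_minus scaleC_minus_right)
lift_definition times_bop :: "'a bop \<Rightarrow> 'a bop \<Rightarrow> 'a bop" is "\<lambda>f g x. f (g x)"
  by (simp add: bounded_linear_compose)
lift_definition scaleC_bop :: "complex \<Rightarrow> 'a bop \<Rightarrow> 'a bop" is "\<lambda>c f x. c *\<^sub>C f x"
  by (auto simp: scaleC_scaleC mult.commute
      intro: bounded_linear_compose[OF bounded_linear_scaleC])

instance
proof
  fix a b c :: "'a bop" and r s :: complex
  show "a + b + c = a + (b + c)" "a + b = b + a" "0 + a = a" "- a + a = 0" "a - b = a + - b"
    "a * b * c = a * (b * c)" "(a + b) * c = a * c + b * c" "1 * a = a" "a * 1 = a"
    by (transfer; simp add: add_ac)+
  show "a * (b + c) = a * b + a * c"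
    by transfer (auto simp: linear_add bounded_linear.linear)
  show "r *\<^sub>C (a + b) = r *\<^sub>C a + r *\<^sub>C b" "(r + s) *\<^sub>C a = r *\<^sub>C a + s *\<^sub>C a"
    "r *\<^sub>C s *\<^sub>C a = (r * s) *\<^sub>C a" "1 *\<^sub>C a = a"
    by (transfer; simp add: scaleC_add_right scaleC_add_left scaleC_scaleC scaleC_one)+
qed

end

definition adj :: "'h::chilbert_space bop \<Rightarrow> 'h bop"
  where "adj a = (THE b. \<forall>x y. cinner (bop_apply a x) y = cinner x (bop_apply b y))"

definition commutant :: "'h::chilbert_space bop set \<Rightarrow> 'h bop set"
  where "commutant S = {b. \<forall>a\<in>S. a * b = b * a}"

definition von_neumann_algebra :: "'h::chilbert_space bop set \<Rightarrow> bool"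
  where "von_neumann_algebra M \<longleftrightarrow> (\<forall>a\<in>M. adj a \<in> M) \<and> commutant (commutant M) = M"

definition positive_bop :: "'h::chilbert_space bop \<Rightarrow> bool"
  where "positive_bop a \<longleftrightarrow> (\<forall>x. cinner (bop_apply a x) x \<in> \<real>\<^sub>\<ge>\<^sub>0)"

definition le_bop :: "'h::chilbert_space bop \<Rightarrow> 'h bop \<Rightarrow> bool"
  where "le_bop a b \<longleftrightarrow> positive_bop (b - a)"

text \<open>A state on \<open>M\<close> is represented by a function on all of \<open>B(H)\<close>, of which only the values
  on \<open>M\<close> are constrained (and used).\<close>

definition state_on :: "'h::chilbert_space bop set \<Rightarrow> ('h bop \<Rightarrow> complex) \<Rightarrow> bool"
  where "state_on M \<phi> \<longleftrightarrow>
    (\<forall>a\<in>M. \<forall>b\<in>M. \<phi> (a + b) = \<phi> a + \<phi> b) \<and>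
    (\<forall>c. \<forall>a\<in>M. \<phi> (c *\<^sub>C a) = c * \<phi> a) \<and>
    (\<forall>a\<in>M. positive_bop a \<longrightarrow> \<phi> a \<in> \<real>\<^sub>\<ge>\<^sub>0) \<and>
    \<phi> 1 = 1"

definition faithful_on :: "'h::chilbert_space bop set \<Rightarrow> ('h bop \<Rightarrow> complex) \<Rightarrow> bool"
  where "faithful_on M \<phi> \<longleftrightarrow> (\<forall>a\<in>M. positive_bop a \<longrightarrow> \<phi> a = 0 \<longrightarrow> a = 0)"

text \<open>Normality: \<open>\<phi>\<close> preserves least upper bounds of upward directed sets of positive
  elements of \<open>M\<close>.\<close>

definition normal_on :: "'h::chilbert_space bop set \<Rightarrow> ('h bop \<Rightarrow> complex) \<Rightarrow> bool"
  where "normal_on M \<phi> \<longleftrightarrow>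
    (\<forall>D s. D \<noteq> {} \<and> D \<subseteq> M \<and> (\<forall>a\<in>D. positive_bop a) \<and>
       (\<forall>a\<in>D. \<forall>b\<in>D. \<exists>c\<in>D. le_bop a c \<and> le_bop b c) \<and>
       s \<in> M \<and> (\<forall>a\<in>D. le_bop a s) \<and> (\<forall>b\<in>M. (\<forall>a\<in>D. le_bop a b) \<longrightarrow> le_bop s b)
       \<longrightarrow> Re (\<phi> s) = (SUP a\<in>D. Re (\<phi> a)))"

section \<open>Algebraic tensor products\<close>

instantiation poly_mapping :: (type, complex_vector) complex_vector
begin

lift_definition scaleC_poly_mapping :: "complex \<Rightarrow> ('a \<Rightarrow>\<^sub>0 'b) \<Rightarrow> 'a \<Rightarrow>\<^sub>0 'b"
  is "\<lambda>c f k. c *\<^sub>C f k"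
  by (metis (mono_tags, lifting) Collect_mono rev_finite_subset scaleC_zero_right)

instance
  by standard (transfer; simp add: scaleC_add_right scaleC_add_left scaleC_scaleC scaleC_one)+

end

text \<open>\<open>'a \<otimes> 'b\<close> is the free complex vector space on \<open>'a \<times> 'b\<close> modulo the bilinearity
  relations.\<close>

abbreviation pure_pair :: "'a \<Rightarrow> 'b \<Rightarrow> ('a \<times> 'b) \<Rightarrow>\<^sub>0 complex"
  where "pure_pair a b \<equiv> Poly_Mapping.single (a, b) 1"

inductive_set tensor_null ::
    "(('a::complex_vector \<times> 'b::complex_vector) \<Rightarrow>\<^sub>0 complex) set" where
  null_zero: "0 \<in> tensor_null"
| null_add: "F \<in> tensor_null \<Longrightarrow> G \<in> tensor_null \<Longrightarrow> F + G \<in> tensor_null"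
| null_scale: "F \<in> tensor_null \<Longrightarrow> c *\<^sub>C F \<in> tensor_null"
| null_add_left: "pure_pair (a + a') b - pure_pair a b - pure_pair a' b \<in> tensor_null"
| null_add_right: "pure_pair a (b + b') - pure_pair a b - pure_pair a b' \<in> tensor_null"
| null_scale_left: "pure_pair (c *\<^sub>C a) b - c *\<^sub>C pure_pair a b \<in> tensor_null"
| null_scale_right: "pure_pair a (c *\<^sub>C b) - c *\<^sub>C pure_pair a b \<in> tensor_null"

lemma null_uminus: "F \<in> tensor_null \<Longrightarrow> - F \<in> tensor_null"
  using null_scale[of F "- 1"] by (simp add: scaleC_minus_left scaleC_one)

lemma null_diff: "F \<in> tensor_null \<Longrightarrow> G \<in> tensor_null \<Longrightarrow> F - G \<in> tensor_null"
  using null_add[OF _ null_uminus] by (metis diff_conv_add_uminus)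

definition tensor_rel ::
    "(('a::complex_vector \<times> 'b::complex_vector) \<Rightarrow>\<^sub>0 complex) \<Rightarrow> (('a \<times> 'b) \<Rightarrow>\<^sub>0 complex) \<Rightarrow> bool"
  where "tensor_rel F G \<longleftrightarrow> F - G \<in> tensor_null"

quotient_type (overloaded) ('a, 'b) tensor =
  "('a::complex_vector \<times> 'b::complex_vector) \<Rightarrow>\<^sub>0 complex" / tensor_rel
proof (rule equivpI)
  show "reflp tensor_rel"
    by (simp add: reflp_def tensor_rel_def null_zero)
  show "symp tensor_rel"
    by (metis (mono_tags, lifting) minus_diff_eq null_uminus sympI tensor_rel_def)
  show "transp tensor_rel"
    unfolding transp_def tensor_rel_def by (metis (no_types, lifting) null_add diff_add_cancel add_diff_eq)
qed

instantiation tensor :: (complex_vector, complex_vector) complex_vector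
begin

lift_definition zero_tensor :: "('a, 'b) tensor" is 0 .
lift_definition plus_tensor :: "('a, 'b) tensor \<Rightarrow> ('a, 'b) tensor \<Rightarrow> ('a, 'b) tensor" is "(+)"
  unfolding tensor_rel_def by (metis (no_types, lifting) add_diff_add null_add)
lift_definition minus_tensor :: "('a, 'b) tensor \<Rightarrow> ('a, 'b) tensor \<Rightarrow> ('a, 'b) tensor" is "(-)"
proof -
  fix F F' G G' :: "('a \<times> 'b) \<Rightarrow>\<^sub>0 complex"
  assume "tensor_rel F F'" "tensor_rel G G'"
  then have "(F - F') - (G - G') \<in> tensor_null" by (simp add: tensor_rel_def null_diff)
  then show "tensor_rel (F - G) (F' - G')" by (simp add: tensor_rel_def algebra_simps)
qed
lift_definition uminus_tensor :: "('a, 'b) tensor \<Rightarrow> ('a, 'b) tensor" is uminus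
  unfolding tensor_rel_def by (metis minus_diff_minus null_uminus)
lift_definition scaleC_tensor :: "complex \<Rightarrow> ('a, 'b) tensor \<Rightarrow> ('a, 'b) tensor" is scaleC
proof -
  fix c and F G :: "('a \<times> 'b) \<Rightarrow>\<^sub>0 complex"
  assume "tensor_rel F G"
  then have "c *\<^sub>C (F + - G) \<in> tensor_null" by (simp add: tensor_rel_def null_scale)
  then show "tensor_rel (c *\<^sub>C F) (c *\<^sub>C G)"
    unfolding scaleC_add_right scaleC_minus_right by (simp add: tensor_rel_def)
qed

instance
proof
  fix a b c :: "('a, 'b) tensor" and r s :: complex
  have e: "tensor_rel F G" if "F = G" for F G :: "('a \<times> 'b) \<Rightarrow>\<^sub>0 complex"
    using that by (simp add: tensor_rel_def null_zero)
  show "a + b + c = a + (b + c)" "a + b = b + a" "0 + a = a" "- a + a = 0" "a - b = a + - b"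
    by (transfer, rule e, simp add: add_ac)+
  show "r *\<^sub>C (a + b) = r *\<^sub>C a + r *\<^sub>C b" "(r + s) *\<^sub>C a = r *\<^sub>C a + s *\<^sub>C a"
    "r *\<^sub>C s *\<^sub>C a = (r * s) *\<^sub>C a" "1 *\<^sub>C a = a"
    by (transfer, rule e, simp add: scaleC_add_right scaleC_add_left scaleC_scaleC scaleC_one)+
qed

end

lift_definition tens :: "'a::complex_vector \<Rightarrow> 'b::complex_vector \<Rightarrow> ('a, 'b) tensor"
    (infixr \<open>\<otimes>\<close> 72) is "\<lambda>a b. pure_pair a b" .

definition cbilinear ::
    "('a::complex_vector \<Rightarrow> 'b::complex_vector \<Rightarrow> 'c::complex_vector) \<Rightarrow> bool"
  where "cbilinear f \<longleftrightarrow>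
    (\<forall>a a' b. f (a + a') b = f a b + f a' b) \<and> (\<forall>a b b'. f a (b + b') = f a b + f a b') \<and>
    (\<forall>c a b. f (c *\<^sub>C a) b = c *\<^sub>C f a b) \<and> (\<forall>c a b. f a (c *\<^sub>C b) = c *\<^sub>C f a b)"

lemma tens_cbilinear: "cbilinear (\<otimes>)"
proof -
  have "(a + a') \<otimes> b - a \<otimes> b - a' \<otimes> b = 0" "a \<otimes> (b + b') - a \<otimes> b - a \<otimes> b' = 0"
    "(c *\<^sub>C a) \<otimes> b - c *\<^sub>C (a \<otimes> b) = 0" "a \<otimes> (c *\<^sub>C b) - c *\<^sub>C (a \<otimes> b) = 0"
    for a a' :: 'a and b b' :: 'b and c
    by (transfer, simp only: tensor_rel_def diff_0_right tensor_null.intros)+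
  then show ?thesis
    unfolding cbilinear_def by (simp add: algebra_simps)
qed

lemma tens_linear:
  "(a + a') \<otimes> b = a \<otimes> b + a' \<otimes> b" "a \<otimes> (b + b') = a \<otimes> b + a \<otimes> b'"
  "(c *\<^sub>C a) \<otimes> b = c *\<^sub>C (a \<otimes> b)" "a \<otimes> (c *\<^sub>C b) = c *\<^sub>C (a \<otimes> b)"
  by (meson tens_cbilinear cbilinear_def)+

text \<open>The linear map on a free vector space determined by its values on the basis.\<close>

definition free_lift :: "('k \<Rightarrow> 'c::complex_vector) \<Rightarrow> ('k \<Rightarrow>\<^sub>0 complex) \<Rightarrow> 'c"
  where "free_lift f F = (\<Sum>k\<in>Poly_Mapping.keys F. Poly_Mapping.lookup F k *\<^sub>C f k)"

text \<open>The linear map induced by a bilinear map \<open>f\<close>. It does not depend on the chosen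
  representative, see \<open>tensor_lift_abs\<close> below.\<close>

definition tensor_lift ::
    "('a::complex_vector \<Rightarrow> 'b::complex_vector \<Rightarrow> 'c::complex_vector) \<Rightarrow> ('a, 'b) tensor \<Rightarrow> 'c"
  where "tensor_lift f z = free_lift (\<lambda>(a, b). f a b) (rep_tensor z)"

lemma free_lift_superset:
  assumes "finite S" "Poly_Mapping.keys F \<subseteq> S"
  shows "free_lift f F = (\<Sum>k\<in>S. Poly_Mapping.lookup F k *\<^sub>C f k)"
  unfolding free_lift_def using assms
  by (intro sum.mono_neutral_left) (auto simp: in_keys_iff)

lemma free_lift_add: "free_lift f (F + G) = free_lift f F + free_lift f G"
proof -
  let ?S = "Poly_Mapping.keys F \<union> Poly_Mapping.keys G"
  have "Poly_Mapping.keys (F + G) \<subseteq> ?S" by (rule Poly_Mapping.keys_add)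
  then show ?thesis
    by (simp add: free_lift_superset[of ?S] lookup_add scaleC_add_left sum.distrib)
qed

lemma free_lift_scaleC: "free_lift f (c *\<^sub>C F) = c *\<^sub>C free_lift f F"
proof -
  have "Poly_Mapping.keys (c *\<^sub>C F) \<subseteq> Poly_Mapping.keys F"
    by (auto simp: in_keys_iff scaleC_poly_mapping.rep_eq)
  then show ?thesis
    by (simp add: free_lift_superset[of "Poly_Mapping.keys F"] scaleC_poly_mapping.rep_eq
        scaleC_sum_right scaleC_scaleC scaleC_complex_def)
qed

lemma free_lift_diff: "free_lift f (F - G) = free_lift f F - free_lift f G"
  using free_lift_add[of f "F - G" G] by simp

lemma free_lift_single: "free_lift f (Poly_Mapping.single k c) = c *\<^sub>C f k"
  by (simp add: free_lift_def)

lemma free_lift_null: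
  assumes "F \<in> tensor_null" "cbilinear f"
  shows "free_lift (\<lambda>(a, b). f a b) F = 0"
  using assms
proof induction
  case null_zero
  then show ?case by (simp add: free_lift_def)
qed (simp_all add: free_lift_add free_lift_scaleC free_lift_diff free_lift_single scaleC_one
      cbilinear_def)

lemma tensor_lift_abs:
  assumes "cbilinear f"
  shows "tensor_lift f (abs_tensor F) = free_lift (\<lambda>(a, b). f a b) F"
proof -
  have "tensor_rel (rep_tensor (abs_tensor F)) F"
    using Quotient3_tensor by (metis Quotient3_rep_abs Quotient3_rel_rep tensor_rel_def
        diff_self null_zero)
  then show ?thesis
    unfolding tensor_lift_def tensor_rel_def
    by (metis assms free_lift_diff free_lift_null eq_iff_diff_eq_0)
qed

lemma tensor_lift_tens: "cbilinear f \<Longrightarrow> tensor_lift f (a \<otimes> b) = f a b"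
  by (simp add: tens.abs_eq tensor_lift_abs free_lift_single scaleC_one)

lemma tensor_lift_add:
  assumes "cbilinear f"
  shows "tensor_lift f (y + z) = tensor_lift f y + tensor_lift f z"
proof (induction y rule: tensor.abs_induct)
  case (1 F)
  show ?case
    by (induction z rule: tensor.abs_induct)
      (simp add: plus_tensor.abs_eq tensor_lift_abs assms free_lift_add)
qed

lemma tensor_lift_scaleC:
  assumes "cbilinear f"
  shows "tensor_lift f (c *\<^sub>C z) = c *\<^sub>C tensor_lift f z"
  by (induction z rule: tensor.abs_induct)
    (simp add: scaleC_tensor.abs_eq tensor_lift_abs assms free_lift_scaleC)

section \<open>Noncommutative polynomials and derivatives\<close>

text \<open>Words over \<open>'n\<close> form the free monoid, written additively because the
  convolution product of \<open>poly_mapping\<close> requires this.\<close>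

instantiation list :: (type) monoid_add
begin
definition zero_list_def: "0 = []"
definition plus_list_def: "u + v = u @ v"
instance by standard (simp_all add: zero_list_def plus_list_def)
end

type_synonym 'n ncpoly = "'n list \<Rightarrow>\<^sub>0 complex"

definition nc_monom :: "'n list \<Rightarrow> 'n ncpoly"
  where "nc_monom w = Poly_Mapping.single w 1"

definition nc_var :: "'n \<Rightarrow> 'n ncpoly"
  where "nc_var i = nc_monom [i]"

definition nc_eval :: "'a::{complex_vector, monoid_mult} ^ 'n \<Rightarrow> 'n ncpoly \<Rightarrow> 'a"
  where "nc_eval X = free_lift (\<lambda>w. \<Prod>i\<leftarrow>w. X $ i)"

text \<open>\<open>\<partial>\<^sub>i w\<close> is the sum of \<open>u \<otimes> v\<close> over all factorisations \<open>w = u t\<^sub>i v\<close>. The lemmas below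
  show that this is the derivation with \<open>\<partial>\<^sub>i t\<^sub>j = \<delta>\<^sub>i\<^sub>j 1 \<otimes> 1\<close>.\<close>

definition word_deriv :: "'n \<Rightarrow> 'n list \<Rightarrow> ('n ncpoly, 'n ncpoly) tensor"
  where "word_deriv i w =
    (\<Sum>k | k < length w \<and> w ! k = i. nc_monom (take k w) \<otimes> nc_monom (drop (Suc k) w))"

definition nc_deriv :: "'n \<Rightarrow> 'n ncpoly \<Rightarrow> ('n ncpoly, 'n ncpoly) tensor"
  where "nc_deriv i = free_lift (word_deriv i)"

definition bimod_left ::
    "'n ncpoly \<Rightarrow> ('n ncpoly, 'n ncpoly) tensor \<Rightarrow> ('n ncpoly, 'n ncpoly) tensor"
  where "bimod_left P = tensor_lift (\<lambda>Q R. (P * Q) \<otimes> R)"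

definition bimod_right ::
    "('n ncpoly, 'n ncpoly) tensor \<Rightarrow> 'n ncpoly \<Rightarrow> ('n ncpoly, 'n ncpoly) tensor"
  where "bimod_right z P = tensor_lift (\<lambda>Q R. Q \<otimes> (R * P)) z"

definition tensor_flip :: "('a::complex_vector, 'b::complex_vector) tensor \<Rightarrow> ('b, 'a) tensor"
  where "tensor_flip = tensor_lift (\<lambda>a b. b \<otimes> a)"

definition tensor_mult :: "('n ncpoly, 'n ncpoly) tensor \<Rightarrow> 'n ncpoly"
  where "tensor_mult = tensor_lift (*)"

definition cyclic_deriv :: "'n \<Rightarrow> 'n ncpoly \<Rightarrow> 'n ncpoly"
  where "cyclic_deriv i P = tensor_mult (tensor_flip (nc_deriv i P))"

definition cyclic_grad :: "'n ncpoly \<Rightarrow> 'n ncpoly ^ 'n"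
  where "cyclic_grad V = (\<chi> i. cyclic_deriv i V)"

definition jacobian :: "'n ncpoly ^ 'n \<Rightarrow> ('n ncpoly, 'n ncpoly) tensor ^ 'n ^ 'n"
  where "jacobian P = (\<chi> i j. nc_deriv j (P $ i))"

lemma scaleC_single: "c *\<^sub>C Poly_Mapping.single k d = Poly_Mapping.single k (c * d)"
  by (intro poly_mapping_eqI)
    (simp add: scaleC_poly_mapping.rep_eq lookup_single when_def scaleC_complex_def)

lemma ncpoly_induct [case_names single add]:
  fixes P :: "'n ncpoly"
  assumes single: "\<And>w c. R (c *\<^sub>C nc_monom w)"
    and add: "\<And>P Q. R P \<Longrightarrow> R Q \<Longrightarrow> R (P + Q)"
  shows "R P"
proof (induction P rule: Poly_Mapping.update_induct)
  case const
  show ?case using single[of 0] by simp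
next
  case (update P w c)
  have "Poly_Mapping.update w c P = c *\<^sub>C nc_monom w + P"
    using update(1) by (intro poly_mapping_eqI)
      (auto simp: update.rep_eq lookup_add scaleC_single nc_monom_def lookup_single
        in_keys_iff when_def)
  then show ?case using add[OF single] update(3) by simp
qed

lemma nc_monom_mult: "nc_monom u * nc_monom v = nc_monom (u @ v)"
  by (simp add: nc_monom_def mult_single plus_list_def)

lemma nc_mult_scaleC:
  fixes P Q :: "'n ncpoly"
  shows "(c *\<^sub>C P) * Q = c *\<^sub>C (P * Q)" "P * (c *\<^sub>C Q) = c *\<^sub>C (P * Q)"
proof -
  show "(c *\<^sub>C P) * Q = c *\<^sub>C (P * Q)"
    by (induction P rule: ncpoly_induct; induction Q rule: ncpoly_induct)
      (simp_all add: scaleC_add_right distrib_left distrib_right scaleC_single nc_monom_def mult_single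
         mult.assoc add_ac)
  show "P * (c *\<^sub>C Q) = c *\<^sub>C (P * Q)"
    by (induction P rule: ncpoly_induct; induction Q rule: ncpoly_induct)
      (simp_all add: scaleC_add_right distrib_left distrib_right scaleC_single nc_monom_def mult_single
         mult_ac add_ac)
qed

lemma bimod_cbilinear:
  "cbilinear (\<lambda>Q R. (P * Q) \<otimes> R)" "cbilinear (\<lambda>Q R. Q \<otimes> (R * P))" for P :: "'n ncpoly"
  using tens_cbilinear by (auto simp: cbilinear_def distrib_left distrib_right nc_mult_scaleC)

lemma bimod_tens:
  "bimod_left P (Q \<otimes> R) = (P * Q) \<otimes> R" "bimod_right (Q \<otimes> R) P = Q \<otimes> (R * P)"
  by (simp_all add: bimod_left_def bimod_right_def tensor_lift_tens bimod_cbilinear)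

lemma bimod_linear:
  "bimod_left P (y + z) = bimod_left P y + bimod_left P z"
  "bimod_right (y + z) P = bimod_right y P + bimod_right z P"
  "bimod_left P (c *\<^sub>C z) = c *\<^sub>C bimod_left P z"
  "bimod_right (c *\<^sub>C z) P = c *\<^sub>C bimod_right z P"
  by (simp_all add: bimod_left_def bimod_right_def tensor_lift_add tensor_lift_scaleC
      bimod_cbilinear)

lemma bimod_zero: "bimod_left P 0 = 0" "bimod_right 0 P = 0"
  using bimod_linear(3,4)[where c = 0] by simp_all

lemma bimod_sum:
  "bimod_left P (\<Sum>k\<in>A. f k) = (\<Sum>k\<in>A. bimod_left P (f k))"
  "bimod_right (\<Sum>k\<in>A. f k) P = (\<Sum>k\<in>A. bimod_right (f k) P)"
  by (induction A rule: infinite_finite_induct; simp add: bimod_zero bimod_linear)+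

lemma bimod_linear_poly:
  "bimod_left (P + Q) z = bimod_left P z + bimod_left Q z"
  "bimod_right z (P + Q) = bimod_right z P + bimod_right z Q"
  "bimod_left (c *\<^sub>C P) z = c *\<^sub>C bimod_left P z"
  "bimod_right z (c *\<^sub>C P) = c *\<^sub>C bimod_right z P"
proof -
  note L = tens_linear nc_mult_scaleC distrib_left distrib_right
  show "bimod_left (P + Q) z = bimod_left P z + bimod_left Q z"
    "bimod_right z (P + Q) = bimod_right z P + bimod_right z Q"
    "bimod_left (c *\<^sub>C P) z = c *\<^sub>C bimod_left P z"
    "bimod_right z (c *\<^sub>C P) = c *\<^sub>C bimod_right z P"
    unfolding bimod_left_def bimod_right_def tensor_lift_def free_lift_def
    by (simp_all add: L scaleC_add_right sum.distrib scaleC_sum_right scaleC_scaleC mult.commute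
        case_prod_beta)
qed

lemma nc_deriv_add: "nc_deriv i (P + Q) = nc_deriv i P + nc_deriv i Q"
  by (simp add: nc_deriv_def free_lift_add)

lemma nc_deriv_scaleC: "nc_deriv i (c *\<^sub>C P) = c *\<^sub>C nc_deriv i P"
  by (simp add: nc_deriv_def free_lift_scaleC)

lemma nc_deriv_monom: "nc_deriv i (nc_monom w) = word_deriv i w"
  by (simp add: nc_deriv_def nc_monom_def free_lift_single scaleC_one)

lemma nc_deriv_var: "nc_deriv i (nc_var j) = (if i = j then 1 \<otimes> 1 else 0)"
proof -
  have "{k. k < length [j] \<and> [j] ! k = i} = (if i = j then {0} else {})" by auto
  moreover have "nc_monom ([] :: 'a list) = 1"
    by (simp add: nc_monom_def zero_list_def[symmetric] single_one)
  ultimately show ?thesis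
    by (simp add: nc_var_def nc_deriv_monom word_deriv_def)
qed

lemma nc_deriv_mult:
  "nc_deriv i (P * Q) = bimod_right (nc_deriv i P) Q + bimod_left P (nc_deriv i Q)"
proof -
  have word: "word_deriv i (u @ v) =
      bimod_right (word_deriv i u) (nc_monom v) + bimod_left (nc_monom u) (word_deriv i v)" for u v
  proof -
    let ?f = "\<lambda>k. nc_monom (take k (u @ v)) \<otimes> nc_monom (drop (Suc k) (u @ v))"
    let ?A = "{k. k < length u \<and> u ! k = i}" and ?B = "{k. k < length v \<and> v ! k = i}"
    have "{k. k < length (u @ v) \<and> (u @ v) ! k = i} = ?A \<union> (+) (length u) ` ?B" (is "?L = ?R")
    proof (intro set_eqI iffI)
      fix k assume k: "k \<in> ?L"
      then show "k \<in> ?R"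
      proof (cases "k < length u")
        case False
        then have "k = length u + (k - length u)" "k - length u \<in> ?B"
          using k by (auto simp: nth_append)
        then show ?thesis by blast
      qed (auto simp: nth_append)
    qed (auto simp: nth_append)
    then have "word_deriv i (u @ v) = sum ?f ?A + sum ?f ((+) (length u) ` ?B)"
      unfolding word_deriv_def by (simp only:) (intro sum.union_disjoint, auto)
    also have "sum ?f ((+) (length u) ` ?B) = (\<Sum>k\<in>?B. ?f (length u + k))"
      by (subst sum.reindex) auto
    also have "\<dots> = bimod_left (nc_monom u) (word_deriv i v)"
      by (simp add: word_deriv_def bimod_sum bimod_tens nc_monom_mult)
    also have "sum ?f ?A = bimod_right (word_deriv i u) (nc_monom v)"
      by (simp add: word_deriv_def bimod_sum bimod_tens nc_monom_mult)
    finally show ?thesis .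
  qed
  show ?thesis
  proof (induction P rule: ncpoly_induct)
    case (single u c)
    show ?case
    proof (induction Q rule: ncpoly_induct)
      case (single v d)
      show ?case
        by (simp add: nc_mult_scaleC nc_deriv_scaleC nc_monom_mult nc_deriv_monom word
            bimod_linear bimod_linear_poly scaleC_add_right scaleC_scaleC mult.commute)
    next
      case (add Q R)
      then show ?case
        by (simp add: distrib_left nc_deriv_add bimod_linear bimod_linear_poly)
    qed
  next
    case (add P R)
    then show ?case
      by (simp add: distrib_right nc_deriv_add bimod_linear bimod_linear_poly)
  qed
qed

section \<open>The tensor product of \<open>M\<close> and its opposite algebra\<close>

text \<open>The opposite algebra of \<open>M\<close> has the same underlying vector space, involution and state;
  only the multiplication differs. So its elements are represented by elements of \<open>M\<close>, and
  the reversal of the product appears in the second leg of \<open>op_mult\<close>. As \<open>M\<close> is a linear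
  subspace of \<open>B(H)\<close>, the algebraic tensor product of \<open>M\<close> and its opposite is the span of
  the elementary tensors with both legs in \<open>M\<close>.\<close>

definition tensor_span ::
    "'a::complex_vector set \<Rightarrow> 'b::complex_vector set \<Rightarrow> ('a, 'b) tensor set"
  where "tensor_span S T = {abs_tensor F | F. Poly_Mapping.keys F \<subseteq> S \<times> T}"

definition op_mult ::
    "('h::chilbert_space bop, 'h bop) tensor \<Rightarrow> ('h bop, 'h bop) tensor \<Rightarrow> ('h bop, 'h bop) tensor"
  where "op_mult y z =
    tensor_lift (\<lambda>a b. tensor_lift (\<lambda>c d. (a * c) \<otimes> (d * b)) z) y"

definition tensor_adj ::
    "('h::chilbert_space bop, 'h bop) tensor \<Rightarrow> ('h bop, 'h bop) tensor"
  where "tensor_adj z =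
    (\<Sum>(a, b)\<in>Poly_Mapping.keys (rep_tensor z).
       cnj (Poly_Mapping.lookup (rep_tensor z) (a, b)) *\<^sub>C (adj a \<otimes> adj b))"

text \<open>\<open>\<phi> \<otimes> \<phi>\<^sup>o\<^sup>p\<close>. Only representatives with legs in \<open>M\<close> are
  considered, because \<open>\<phi>\<close> need not be linear outside \<open>M\<close>.\<close>

definition tensor_state ::
    "'h::chilbert_space bop set \<Rightarrow> ('h bop \<Rightarrow> complex) \<Rightarrow> ('h bop, 'h bop) tensor \<Rightarrow> complex"
  where "tensor_state M \<phi> z =
    (THE c. \<exists>F. Poly_Mapping.keys F \<subseteq> M \<times> M \<and> abs_tensor F = z \<and>
       c = free_lift (\<lambda>(a, b). \<phi> a * \<phi> b) F)"

definition tensor_eval ::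
    "'h::chilbert_space bop ^ 'n \<Rightarrow> ('n ncpoly, 'n ncpoly) tensor \<Rightarrow> ('h bop, 'h bop) tensor"
  where "tensor_eval X = tensor_lift (\<lambda>P Q. nc_eval X P \<otimes> nc_eval X Q)"

definition vec_eval :: "'h::chilbert_space bop ^ 'n \<Rightarrow> 'n ncpoly ^ 'n \<Rightarrow> 'h bop ^ 'n"
  where "vec_eval X P = (\<chi> i. nc_eval X (P $ i))"

definition mat_eval ::
    "'h::chilbert_space bop ^ 'n \<Rightarrow> ('n ncpoly, 'n ncpoly) tensor ^ 'n ^ 'n
      \<Rightarrow> ('h bop, 'h bop) tensor ^ 'n ^ 'n"
  where "mat_eval X J = (\<chi> i j. tensor_eval X (J $ i $ j))"

section \<open>Inner products and completion\<close>

definition ip_norm :: "('e \<Rightarrow> 'e \<Rightarrow> complex) \<Rightarrow> 'e \<Rightarrow> real"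
  where "ip_norm ip x = sqrt (Re (ip x x))"

definition alg_ip :: "('h::chilbert_space bop \<Rightarrow> complex) \<Rightarrow> 'h bop \<Rightarrow> 'h bop \<Rightarrow> complex"
  where "alg_ip \<phi> a b = \<phi> (a * adj b)"

definition vec_ip ::
    "('h::chilbert_space bop \<Rightarrow> complex) \<Rightarrow> 'h bop ^ 'n \<Rightarrow> 'h bop ^ 'n \<Rightarrow> complex"
  where "vec_ip \<phi> X Y = (\<Sum>i\<in>UNIV. alg_ip \<phi> (X $ i) (Y $ i))"

definition tensor_ip ::
    "'h::chilbert_space bop set \<Rightarrow> ('h bop \<Rightarrow> complex)
      \<Rightarrow> ('h bop, 'h bop) tensor \<Rightarrow> ('h bop, 'h bop) tensor \<Rightarrow> complex"
  where "tensor_ip M \<phi> y z = tensor_state M \<phi> (op_mult y (tensor_adj z))"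

definition mat_ip ::
    "'h::chilbert_space bop set \<Rightarrow> ('h bop \<Rightarrow> complex)
      \<Rightarrow> ('h bop, 'h bop) tensor ^ 'n ^ 'n \<Rightarrow> ('h bop, 'h bop) tensor ^ 'n ^ 'n \<Rightarrow> complex"
  where "mat_ip M \<phi> A B = (\<Sum>i\<in>UNIV. \<Sum>j\<in>UNIV. tensor_ip M \<phi> (A $ i $ j) (B $ i $ j))"

text \<open>The Hilbert space completion of an inner product space \<open>(E, ip)\<close>: classes of Cauchy
  sequences modulo null sequences. Inner product and difference are computed on
  representatives, and do not depend on their choice.\<close>

definition cauchy_seqs ::
    "'e::ab_group_add set \<Rightarrow> ('e \<Rightarrow> 'e \<Rightarrow> complex) \<Rightarrow> (nat \<Rightarrow> 'e) set"
  where "cauchy_seqs E ip = {S. (\<forall>k. S k \<in> E) \<and>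
    (\<forall>e>0. \<exists>N. \<forall>k\<ge>N. \<forall>l\<ge>N. ip_norm ip (S k - S l) < e)}"

definition seq_equiv ::
    "'e::ab_group_add set \<Rightarrow> ('e \<Rightarrow> 'e \<Rightarrow> complex) \<Rightarrow> ((nat \<Rightarrow> 'e) \<times> (nat \<Rightarrow> 'e)) set"
  where "seq_equiv E ip = {(S, T). S \<in> cauchy_seqs E ip \<and> T \<in> cauchy_seqs E ip \<and>
    (\<lambda>k. ip_norm ip (S k - T k)) \<longlonglongrightarrow> 0}"

definition completion ::
    "'e::ab_group_add set \<Rightarrow> ('e \<Rightarrow> 'e \<Rightarrow> complex) \<Rightarrow> (nat \<Rightarrow> 'e) set set"
  where "completion E ip = cauchy_seqs E ip // seq_equiv E ip"

definition compl_embed ::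
    "'e::ab_group_add set \<Rightarrow> ('e \<Rightarrow> 'e \<Rightarrow> complex) \<Rightarrow> 'e \<Rightarrow> (nat \<Rightarrow> 'e) set"
  where "compl_embed E ip x = seq_equiv E ip `` {\<lambda>_. x}"

definition compl_diff ::
    "'e::ab_group_add set \<Rightarrow> ('e \<Rightarrow> 'e \<Rightarrow> complex)
      \<Rightarrow> (nat \<Rightarrow> 'e) set \<Rightarrow> (nat \<Rightarrow> 'e) set \<Rightarrow> (nat \<Rightarrow> 'e) set"
  where "compl_diff E ip A B = (\<Union>S\<in>A. \<Union>T\<in>B. seq_equiv E ip `` {\<lambda>k. S k - T k})"

definition compl_ip ::
    "('e \<Rightarrow> 'e \<Rightarrow> complex) \<Rightarrow> (nat \<Rightarrow> 'e) set \<Rightarrow> (nat \<Rightarrow> 'e) set \<Rightarrow> complex"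
  where "compl_ip ip A B = (THE c. \<exists>S\<in>A. \<exists>T\<in>B. (\<lambda>k. ip (S k) (T k)) \<longlonglongrightarrow> c)"

section \<open>Free Stein kernels and the free Poincare inequality\<close>

definition tensor_mats ::
    "'h::chilbert_space bop set \<Rightarrow> (('h bop, 'h bop) tensor ^ 'n ^ 'n) set"
  where "tensor_mats M = {A. \<forall>i j. A $ i $ j \<in> tensor_span M M}"

text \<open>\<open>L\<^sup>2\<close> of the \<open>n \<times> n\<close> matrices over the tensor product of \<open>M\<close> and its opposite.
  Completing the matrices over the algebraic tensor product gives the same space as completing
  those over the von Neumann algebraic one, in which the former are \<open>L\<^sup>2\<close>-dense.\<close>

definition L2_mats ::
    "'h::chilbert_space bop set \<Rightarrow> ('h bop \<Rightarrow> complex)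
      \<Rightarrow> (nat \<Rightarrow> ('h bop, 'h bop) tensor ^ 'n ^ 'n) set set"
  where "L2_mats M \<phi> = completion (tensor_mats M) (mat_ip M \<phi>)"

definition L2_embed ::
    "'h::chilbert_space bop set \<Rightarrow> ('h bop \<Rightarrow> complex)
      \<Rightarrow> ('h bop, 'h bop) tensor ^ 'n ^ 'n \<Rightarrow> (nat \<Rightarrow> ('h bop, 'h bop) tensor ^ 'n ^ 'n) set"
  where "L2_embed M \<phi> = compl_embed (tensor_mats M) (mat_ip M \<phi>)"

definition L2_ip ::
    "'h::chilbert_space bop set \<Rightarrow> ('h bop \<Rightarrow> complex)
      \<Rightarrow> (nat \<Rightarrow> ('h bop, 'h bop) tensor ^ 'n ^ 'n) set
      \<Rightarrow> (nat \<Rightarrow> ('h bop, 'h bop) tensor ^ 'n ^ 'n) set \<Rightarrow> complex"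
  where "L2_ip M \<phi> = compl_ip (mat_ip M \<phi>)"

definition free_stein_kernel ::
    "'h::chilbert_space bop set \<Rightarrow> ('h bop \<Rightarrow> complex) \<Rightarrow> 'h bop ^ 'n \<Rightarrow> 'n ncpoly
      \<Rightarrow> (nat \<Rightarrow> ('h bop, 'h bop) tensor ^ 'n ^ 'n) set \<Rightarrow> bool"
  where "free_stein_kernel M \<phi> X V A \<longleftrightarrow> A \<in> L2_mats M \<phi> \<and>
    (\<forall>P. vec_ip \<phi> (vec_eval X (cyclic_grad V)) (vec_eval X P) =
         L2_ip M \<phi> A (L2_embed M \<phi> (mat_eval X (jacobian P))))"

text \<open>The norm of \<open>A - (1 \<otimes> 1) \<otimes> I\<^sub>n\<close>.\<close>

definition stein_dist ::
    "'h::chilbert_space bop set \<Rightarrow> ('h bop \<Rightarrow> complex)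
      \<Rightarrow> (nat \<Rightarrow> ('h bop, 'h bop) tensor ^ 'n ^ 'n) set \<Rightarrow> real"
  where "stein_dist M \<phi> A = ip_norm (L2_ip M \<phi>)
    (compl_diff (tensor_mats M) (mat_ip M \<phi>) A (L2_embed M \<phi> (mat (1 \<otimes> 1))))"

definition free_stein_discrepancy ::
    "'h::chilbert_space bop set \<Rightarrow> ('h bop \<Rightarrow> complex) \<Rightarrow> 'h bop ^ 'n \<Rightarrow> 'n ncpoly \<Rightarrow> real"
  where "free_stein_discrepancy M \<phi> X V =
    (INF A\<in>{A. free_stein_kernel M \<phi> X V A}. stein_dist M \<phi> A)"

definition free_poincare ::
    "'h::chilbert_space bop set \<Rightarrow> ('h bop \<Rightarrow> complex) \<Rightarrow> 'h bop ^ 'n \<Rightarrow> real \<Rightarrow> bool"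
  where "free_poincare M \<phi> X c \<longleftrightarrow>
    (\<forall>P. (ip_norm (alg_ip \<phi>) (nc_eval X P - \<phi> (nc_eval X P) *\<^sub>C 1))\<^sup>2
       \<le> c * (\<Sum>i\<in>UNIV. (ip_norm (tensor_ip M \<phi>) (tensor_eval X (nc_deriv i P)))\<^sup>2))"

text \<open>The infimum is over a nonempty set, because \<open>X\<close> is bounded: \<open>4 \<Sum>\<^sub>i \<parallel>x\<^sub>i\<parallel>\<^sup>2\<close> is
  an admissible constant.\<close>

definition C_opt ::
    "'h::chilbert_space bop set \<Rightarrow> ('h bop \<Rightarrow> complex) \<Rightarrow> 'h bop ^ 'n \<Rightarrow> real"
  where "C_opt M \<phi> X = Inf {c. free_poincare M \<phi> X c}"

end

theory Submission
  imports Defs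
begin

text \<open>
  A free Stein kernel is a vector representing a bounded functional. On
  \<open>\<P>\<^sup>n\<close> consider the semi-inner product
  \<open>q(P, Q) = \<langle>[\<J>P](X), [\<J>Q](X)\<rangle>\<close> and the functional
  \<open>L(P) = \<langle>P(X), [\<D>V](X)\<rangle>\<close>. Since the entries of \<open>[\<D>V](X)\<close> are centered,
  each \<open>P\<^sub>i(X)\<close> may be replaced by \<open>P\<^sub>i(X) - \<phi>(P\<^sub>i(X))\<close> in \<open>L(P)\<close>. The
  Cauchy-Schwarz inequality and the free Poincare inequality then give
  \<open>\<bar>L(P)\<bar>\<^sup>2 \<le> C q(P, P)\<close> with \<open>C = C\<^sub>o\<^sub>p\<^sub>t \<parallel>[\<D>V](X)\<parallel>\<^sup>2\<close>.
  The Riesz theorem yields \<open>A\<close> in the closure of \<open>{[\<J>P](X)}\<close> with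
  \<open>\<langle>A, [\<J>P](X)\<rangle> = \<langle>[\<D>V](X), P(X)\<rangle>\<close> and \<open>\<parallel>A\<parallel>\<^sup>2 \<le> C\<close>. The identity matrix
  is the Jacobian of \<open>(t\<^sub>1, \<dots>, t\<^sub>n)\<close>, so \<open>\<langle>A, 1\<rangle> = \<langle>[\<D>V](X), X\<rangle>\<close>, and expanding
  \<open>\<parallel>A - 1\<parallel>\<^sup>2 = \<parallel>A\<parallel>\<^sup>2 - 2 Re \<langle>A, 1\<rangle> + n\<close> gives the estimate. For
  \<open>V = (1/2) \<Sum>\<^sub>i t\<^sub>i\<^sup>2\<close> the cyclic gradient is \<open>(t\<^sub>1, \<dots>, t\<^sub>n)\<close> and the bound reads
  \<open>n + n C\<^sub>o\<^sub>p\<^sub>t - 2 n\<close>.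

  The Riesz theorem is needed on \<open>\<P>\<^sup>n\<close>, which is neither complete nor separated for
  \<open>q\<close>, and on the underlying Hilbert space, where it provides adjoints. Both come from
  \<open>riesz_sequence\<close>: the quadratic functional \<open>q(P, P) - 2 Re L(P)\<close> has Cauchy
  minimising sequences, and these represent \<open>L\<close> in the limit. The class of such
  a sequence is a point of the completion, and in a Hilbert space the sequence converges.

  Two more facts carry the proof. First, the form on \<open>M \<otimes> M\<^sup>o\<^sup>p\<close> is positive
  semidefinite; for \<open>z = \<Sum>\<^sub>k a\<^sub>k \<otimes> b\<^sub>k\<close> its value is
  \<open>\<Sum>\<^sub>k\<^sub>l \<phi>(a\<^sub>k a\<^sub>l\<^sup>*) \<phi>(b\<^sub>l\<^sup>* b\<^sub>k)\<close>, a sum over the entrywise product of two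
  Gram matrices, so the Schur product theorem (\<open>schur_product_nonneg\<close>) applies. Second,
  \<open>C\<^sub>o\<^sub>p\<^sub>t\<close>, defined as an infimum, is itself an admissible constant. This requires
  that some admissible constant exists (\<open>free_poincare_exists\<close>), which follows from
  \<open>\<Sum>\<^sub>i \<partial>\<^sub>iP \<sharp> (t\<^sub>i \<otimes> 1 - 1 \<otimes> t\<^sub>i) = P \<otimes> 1 - 1 \<otimes> P\<close> and the boundedness of
  right multiplication by elementary tensors.
\<close>

section \<open>Positive semidefinite sesquilinear forms\<close>

text \<open>The carrier is a linear subspace because a state is linear only on the algebra and says
  nothing about the operators outside it. Degenerate forms are included: the
  constants lie in the kernel of \<open>\<langle>[\<J>P](X), [\<J>Q](X)\<rangle>\<close>. Hermitian symmetry is a consequence of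
  positivity over the complex numbers.\<close>

locale psd_form =
  fixes E :: "'e::complex_vector set" and ip :: "'e \<Rightarrow> 'e \<Rightarrow> complex"
  assumes zero_mem: "0 \<in> E"
    and add_mem: "x \<in> E \<Longrightarrow> y \<in> E \<Longrightarrow> x + y \<in> E"
    and scaleC_mem: "x \<in> E \<Longrightarrow> c *\<^sub>C x \<in> E"
    and add_left: "x \<in> E \<Longrightarrow> y \<in> E \<Longrightarrow> z \<in> E \<Longrightarrow> ip (x + y) z = ip x z + ip y z"
    and add_right: "x \<in> E \<Longrightarrow> y \<in> E \<Longrightarrow> z \<in> E \<Longrightarrow> ip z (x + y) = ip z x + ip z y"
    and scaleC_left: "x \<in> E \<Longrightarrow> y \<in> E \<Longrightarrow> ip (c *\<^sub>C x) y = c * ip x y"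
    and scaleC_right: "x \<in> E \<Longrightarrow> y \<in> E \<Longrightarrow> ip x (c *\<^sub>C y) = cnj c * ip x y"
    and nonneg: "x \<in> E \<Longrightarrow> ip x x \<in> \<real>\<^sub>\<ge>\<^sub>0"
begin

abbreviation N :: "'e \<Rightarrow> real" where "N \<equiv> ip_norm ip"

lemma uminus_scaleC: "- x = (- 1) *\<^sub>C x" for x :: 'e
  by (simp add: scaleC_minus_left scaleC_one)

lemma uminus_mem: "x \<in> E \<Longrightarrow> - x \<in> E"
  by (simp only: uminus_scaleC scaleC_mem)

lemma diff_mem: "x \<in> E \<Longrightarrow> y \<in> E \<Longrightarrow> x - y \<in> E"
  using add_mem[OF _ uminus_mem, of x y] by simp

lemma diff_left: "x \<in> E \<Longrightarrow> y \<in> E \<Longrightarrow> z \<in> E \<Longrightarrow> ip (x - y) z = ip x z - ip y z"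
  using add_left[of "x - y" y z] diff_mem by simp

lemma diff_right: "x \<in> E \<Longrightarrow> y \<in> E \<Longrightarrow> z \<in> E \<Longrightarrow> ip z (x - y) = ip z x - ip z y"
  using add_right[of "x - y" y z] diff_mem by simp

lemma self_eq: "x \<in> E \<Longrightarrow> ip x x = complex_of_real ((N x)\<^sup>2)"
  using nonneg[of x] by (auto simp: ip_norm_def complex_nonneg_Reals_iff complex_eq_iff)

lemma N_nonneg: "x \<in> E \<Longrightarrow> 0 \<le> N x"
  using nonneg[of x] by (auto simp: ip_norm_def complex_nonneg_Reals_iff)

lemma N_sq: "x \<in> E \<Longrightarrow> (N x)\<^sup>2 = Re (ip x x)"
  by (simp add: self_eq)

lemma Im_self: "x \<in> E \<Longrightarrow> Im (ip x x) = 0"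
  by (simp add: self_eq)

text \<open>Polarisation: the form is real on the diagonal, in particular at \<open>x + y\<close> and at
  \<open>x + i y\<close>.\<close>

lemma hermitian:
  assumes "x \<in> E" "y \<in> E"
  shows "ip y x = cnj (ip x y)"
proof -
  note L = add_left add_right scaleC_left scaleC_right add_mem scaleC_mem assms
  have "Im (ip (x + y) (x + y)) = 0" "Im (ip (x + \<i> *\<^sub>C y) (x + \<i> *\<^sub>C y)) = 0"
    by (intro Im_self add_mem scaleC_mem assms)+
  moreover have "ip (x + y) (x + y) = ip x x + ip x y + ip y x + ip y y"
    by (simp add: L)
  moreover have "ip (x + \<i> *\<^sub>C y) (x + \<i> *\<^sub>C y) = ip x x - \<i> * ip x y + \<i> * ip y x + ip y y"
    by (simp add: L algebra_simps)
  ultimately show ?thesis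
    using assms by (simp add: complex_eq_iff Im_self)
qed

lemma N_sq_add:
  assumes "x \<in> E" "y \<in> E"
  shows "(N (x + y))\<^sup>2 = (N x)\<^sup>2 + 2 * Re (ip x y) + (N y)\<^sup>2"
  using assms by (simp add: N_sq add_mem add_left add_right hermitian[of x y])

lemma N_sq_diff:
  assumes "x \<in> E" "y \<in> E"
  shows "(N (x - y))\<^sup>2 = (N x)\<^sup>2 - 2 * Re (ip x y) + (N y)\<^sup>2"
  using assms by (simp add: N_sq diff_mem diff_left diff_right hermitian[of x y])

lemma N_scaleC:
  assumes "x \<in> E"
  shows "N (c *\<^sub>C x) = cmod c * N x"
proof (rule power2_eq_imp_eq)
  have "ip (c *\<^sub>C x) (c *\<^sub>C x) = (c * cnj c) * ip x x"
    using assms by (simp add: scaleC_left scaleC_right scaleC_mem)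
  also have "\<dots> = complex_of_real ((cmod c * N x)\<^sup>2)"
    using assms by (simp add: self_eq complex_norm_square[symmetric] power_mult_distrib)
  finally show "(N (c *\<^sub>C x))\<^sup>2 = (cmod c * N x)\<^sup>2"
    using assms by (simp add: N_sq scaleC_mem)
qed (use assms N_nonneg scaleC_mem in auto)

lemma N_zero: "N 0 = 0"
  using N_scaleC[OF zero_mem, of 0] by simp

lemma cauchy_schwarz:
  assumes x: "x \<in> E" and y: "y \<in> E"
  shows "cmod (ip x y) \<le> N x * N y"
proof -
  define h where "h = ip x y"
  have quad: "0 \<le> (N x)\<^sup>2 - 2 * t * (cmod h)\<^sup>2 + t\<^sup>2 * (cmod h)\<^sup>2 * (N y)\<^sup>2" for t :: real
  proof -
    let ?c = "complex_of_real t * h"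
    have "Re (ip x (?c *\<^sub>C y)) = t * (cmod h)\<^sup>2"
      using x y by (simp add: scaleC_right h_def[symmetric] cmod_power2)
          (simp add: algebra_simps power2_eq_square)
    then have "(N (x - ?c *\<^sub>C y))\<^sup>2 = (N x)\<^sup>2 - 2 * t * (cmod h)\<^sup>2 + t\<^sup>2 * (cmod h)\<^sup>2 * (N y)\<^sup>2"
      using x y by (simp add: N_sq_diff scaleC_mem N_scaleC norm_mult power_mult_distrib)
    then show ?thesis by (metis zero_le_power2)
  qed
  have "(cmod h)\<^sup>2 \<le> (N x)\<^sup>2 * (N y)\<^sup>2"
  proof (cases "N y = 0")
    case True
    have "h = 0"
    proof (rule ccontr)
      assume "h \<noteq> 0"
      then have "0 < (cmod h)\<^sup>2" by simp
      then have "(N x)\<^sup>2 - 2 * (((N x)\<^sup>2 + 1) / (cmod h)\<^sup>2) * (cmod h)\<^sup>2 < 0"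
        using le_less_trans[of "- (N x)\<^sup>2" 0 2] by simp
      then show False using quad[of "((N x)\<^sup>2 + 1) / (cmod h)\<^sup>2"] True by simp
    qed
    then show ?thesis by simp
  next
    case False
    define D where "D = (N y)\<^sup>2"
    have D: "D > 0" using False by (simp add: D_def)
    have "(1 / D)\<^sup>2 * (cmod h)\<^sup>2 * D = (cmod h)\<^sup>2 / D"
      using D by (simp add: power2_eq_square)
    then have "(cmod h)\<^sup>2 / D \<le> (N x)\<^sup>2"
      using quad[of "1 / D"] by (simp add: D_def[symmetric])
    then show ?thesis
      using D by (simp add: D_def[symmetric] divide_le_eq)
  qed
  then have "(cmod h)\<^sup>2 \<le> (N x * N y)\<^sup>2" by (simp add: power_mult_distrib)
  then show ?thesis
    unfolding h_def by (rule power2_le_imp_le) (simp add: x y N_nonneg)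
qed

lemma triangle:
  assumes "x \<in> E" "y \<in> E"
  shows "N (x + y) \<le> N x + N y"
proof (rule power2_le_imp_le)
  have "Re (ip x y) \<le> N x * N y"
    using cauchy_schwarz[OF assms] complex_Re_le_cmod order_trans by blast
  then show "(N (x + y))\<^sup>2 \<le> (N x + N y)\<^sup>2"
    using assms by (simp add: N_sq_add power2_sum)
qed (use assms N_nonneg in auto)

lemma N_minus_commute: "x \<in> E \<Longrightarrow> y \<in> E \<Longrightarrow> N (x - y) = N (y - x)"
  using N_scaleC[of "x - y" "- 1"] diff_mem by (simp add: scaleC_minus_left scaleC_one)

lemma sum_mem: "(\<And>k. k \<in> I \<Longrightarrow> u k \<in> E) \<Longrightarrow> sum u I \<in> E"
  by (induction I rule: infinite_finite_induct) (auto simp: zero_mem add_mem)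

lemma ip_zero: "x \<in> E \<Longrightarrow> ip 0 x = 0" "x \<in> E \<Longrightarrow> ip x 0 = 0"
  using scaleC_left[of x x 0] scaleC_right[of x x 0] by simp_all

lemma ip_sum_left: "(\<And>k. k \<in> I \<Longrightarrow> u k \<in> E) \<Longrightarrow> x \<in> E \<Longrightarrow> ip (sum u I) x = (\<Sum>k\<in>I. ip (u k) x)"
  by (induction I rule: infinite_finite_induct) (auto simp: ip_zero add_left sum_mem)

lemma ip_sum_right: "(\<And>k. k \<in> I \<Longrightarrow> u k \<in> E) \<Longrightarrow> x \<in> E \<Longrightarrow> ip x (sum u I) = (\<Sum>k\<in>I. ip x (u k))"
  by (induction I rule: infinite_finite_induct) (auto simp: ip_zero add_right sum_mem)

lemma ip_sum:
  assumes "\<And>k. k \<in> I \<Longrightarrow> u k \<in> E" "\<And>l. l \<in> J \<Longrightarrow> v l \<in> E"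
  shows "ip (sum u I) (sum v J) = (\<Sum>k\<in>I. \<Sum>l\<in>J. ip (u k) (v l))"
  using assms by (subst ip_sum_left) (auto simp: sum_mem ip_sum_right intro!: sum.cong)

lemma N_sum: "(\<And>k. k \<in> I \<Longrightarrow> u k \<in> E) \<Longrightarrow> N (sum u I) \<le> (\<Sum>k\<in>I. N (u k))"
proof (induction I rule: infinite_finite_induct)
  case (insert k I)
  then show ?case using triangle[of "u k" "sum u I"] by (simp add: sum_mem)
qed (simp_all add: N_zero)

lemma ip_diff_bound:
  assumes "x \<in> E" "y \<in> E" "x' \<in> E" "y' \<in> E"
  shows "cmod (ip x y - ip x' y') \<le> N (x - x') * N y + N x' * N (y - y')"
proof -
  have "ip x y - ip x' y' = ip (x - x') y + ip x' (y - y')"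
    using assms by (simp add: diff_left diff_right)
  also have "cmod \<dots> \<le> cmod (ip (x - x') y) + cmod (ip x' (y - y'))"
    by (rule norm_triangle_ineq)
  also have "\<dots> \<le> N (x - x') * N y + N x' * N (y - y')"
    using assms by (intro add_mono cauchy_schwarz diff_mem)
  finally show ?thesis .
qed

section \<open>The Hilbert space completion\<close>

lemma cauchy_mem: "S \<in> cauchy_seqs E ip \<Longrightarrow> S k \<in> E"
  by (simp add: cauchy_seqs_def)

lemma cauchyD:
  assumes "S \<in> cauchy_seqs E ip" "e > 0"
  obtains n where "\<And>k l. k \<ge> n \<Longrightarrow> l \<ge> n \<Longrightarrow> N (S k - S l) < e"
proof -
  have "\<forall>e>0. \<exists>n. \<forall>k\<ge>n. \<forall>l\<ge>n. N (S k - S l) < e"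
    using assms(1) by (simp add: cauchy_seqs_def)
  then show ?thesis using assms(2) that by blast
qed

lemma cauchy_const: "x \<in> E \<Longrightarrow> (\<lambda>_. x) \<in> cauchy_seqs E ip"
  by (simp add: cauchy_seqs_def N_zero)

lemma cauchy_diff:
  assumes S: "S \<in> cauchy_seqs E ip" and T: "T \<in> cauchy_seqs E ip"
  shows "(\<lambda>k. S k - T k) \<in> cauchy_seqs E ip"
proof -
  have "\<exists>n. \<forall>k\<ge>n. \<forall>l\<ge>n. N ((S k - T k) - (S l - T l)) < e" if "e > 0" for e
  proof -
    obtain n1 where n1: "\<And>k l. k \<ge> n1 \<Longrightarrow> l \<ge> n1 \<Longrightarrow> N (S k - S l) < e / 2"
      by (rule cauchyD[OF S, of "e / 2"]) (use \<open>e > 0\<close> in auto)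
    obtain n2 where n2: "\<And>k l. k \<ge> n2 \<Longrightarrow> l \<ge> n2 \<Longrightarrow> N (T k - T l) < e / 2"
      by (rule cauchyD[OF T, of "e / 2"]) (use \<open>e > 0\<close> in auto)
    have "N ((S k - T k) - (S l - T l)) < e" if "k \<ge> max n1 n2" "l \<ge> max n1 n2" for k l
    proof -
      have eq: "(S k - T k) - (S l - T l) = (S k - S l) + (T l - T k)" by simp
      have "N ((S k - T k) - (S l - T l)) \<le> N (S k - S l) + N (T l - T k)"
        unfolding eq by (intro triangle diff_mem cauchy_mem S T)
      also have "\<dots> < e / 2 + e / 2"
        using n1[of k l] n2[of l k] that by (intro add_strict_mono) auto
      finally show ?thesis by simp
    qed
    then show ?thesis by blast
  qed
  then show ?thesis
    unfolding cauchy_seqs_def using cauchy_mem[OF S] cauchy_mem[OF T] by (simp add: diff_mem)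
qed

lemma cauchy_bounded:
  assumes S: "S \<in> cauchy_seqs E ip"
  obtains B where "B > 0" "\<And>k. N (S k) \<le> B"
proof -
  obtain n where n: "\<And>k l. k \<ge> n \<Longrightarrow> l \<ge> n \<Longrightarrow> N (S k - S l) < 1"
    by (rule cauchyD[OF S, of 1]) auto
  define B where "B = (\<Sum>k\<le>n. N (S k)) + 1"
  have le: "N (S k) \<le> (\<Sum>k\<le>n. N (S k))" if "k \<le> n" for k
    using that by (intro member_le_sum) (auto simp: N_nonneg cauchy_mem[OF S])
  have "N (S k) \<le> B" for k
  proof (cases "k \<le> n")
    case True
    then show ?thesis using le[of k] by (simp add: B_def)
  next
    case False
    have "N (S k) \<le> N (S k - S n) + N (S n)"
      using triangle[of "S k - S n" "S n"] cauchy_mem[OF S] diff_mem by simp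
    then show ?thesis using n[of k n] False le[of n] by (simp add: B_def)
  qed
  moreover have "B > 0"
    unfolding B_def by (intro add_nonneg_pos sum_nonneg) (auto simp: N_nonneg cauchy_mem[OF S])
  ultimately show ?thesis using that by blast
qed

lemma ip_convergent:
  assumes S: "S \<in> cauchy_seqs E ip" and T: "T \<in> cauchy_seqs E ip"
  shows "convergent (\<lambda>k. ip (S k) (T k))"
proof -
  obtain A where A: "A > 0" "\<And>k. N (S k) \<le> A" using cauchy_bounded[OF S] by blast
  obtain B where B: "B > 0" "\<And>k. N (T k) \<le> B" using cauchy_bounded[OF T] by blast
  have "Cauchy (\<lambda>k. ip (S k) (T k))"
  proof (rule metric_CauchyI)
    fix e :: real assume "e > 0"
    then have e: "e / (2 * B) > 0" "e / (2 * A) > 0" using A B by auto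
    obtain n1 where n1: "\<And>k l. k \<ge> n1 \<Longrightarrow> l \<ge> n1 \<Longrightarrow> N (S k - S l) < e / (2 * B)"
      using cauchyD[OF S e(1)] by blast
    obtain n2 where n2: "\<And>k l. k \<ge> n2 \<Longrightarrow> l \<ge> n2 \<Longrightarrow> N (T k - T l) < e / (2 * A)"
      using cauchyD[OF T e(2)] by blast
    have "dist (ip (S k) (T k)) (ip (S l) (T l)) < e" if "k \<ge> max n1 n2" "l \<ge> max n1 n2" for k l
    proof -
      have "dist (ip (S k) (T k)) (ip (S l) (T l))
          \<le> N (S k - S l) * N (T k) + N (S l) * N (T k - T l)"
        unfolding dist_norm by (intro ip_diff_bound cauchy_mem S T)
      also have "\<dots> \<le> N (S k - S l) * B + A * N (T k - T l)"
        using A B by (intro add_mono mult_left_mono mult_right_mono N_nonneg diff_mem cauchy_mem S T)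
      also have "\<dots> < e / (2 * B) * B + A * (e / (2 * A))"
        using A B n1[of k l] n2[of k l] that
        by (intro add_strict_mono mult_strict_left_mono mult_strict_right_mono) auto
      also have "\<dots> = e" using A B by simp
      finally show ?thesis .
    qed
    then show "\<exists>n. \<forall>k\<ge>n. \<forall>l\<ge>n. dist (ip (S k) (T k)) (ip (S l) (T l)) < e" by blast
  qed
  then show ?thesis by (rule Cauchy_convergent)
qed

lemma seq_equivD:
  assumes "(S, T) \<in> seq_equiv E ip"
  shows "S \<in> cauchy_seqs E ip" "T \<in> cauchy_seqs E ip" "(\<lambda>k. N (S k - T k)) \<longlonglongrightarrow> 0"
  using assms by (auto simp: seq_equiv_def)

lemma seq_equivI:
  "S \<in> cauchy_seqs E ip \<Longrightarrow> T \<in> cauchy_seqs E ip \<Longrightarrow> (\<lambda>k. N (S k - T k)) \<longlonglongrightarrow> 0 \<Longrightarrow>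
    (S, T) \<in> seq_equiv E ip"
  unfolding seq_equiv_def by blast

lemma seq_equiv_diff:
  assumes S: "(S, S') \<in> seq_equiv E ip" and T: "(T, T') \<in> seq_equiv E ip"
  shows "((\<lambda>k. S k - T k), (\<lambda>k. S' k - T' k)) \<in> seq_equiv E ip"
proof -
  note SD = seq_equivD[OF S] and TD = seq_equivD[OF T]
  have "(\<lambda>k. N ((S k - T k) - (S' k - T' k))) \<longlonglongrightarrow> 0"
  proof (rule Lim_null_comparison[OF always_eventually])
    show "(\<lambda>k. N (S k - S' k) + N (T k - T' k)) \<longlonglongrightarrow> 0"
      using tendsto_add[OF SD(3) TD(3)] by simp
    have "N ((S k - T k) - (S' k - T' k)) \<le> N (S k - S' k) + N (T k - T' k)" for k
    proof -
      have "N ((S k - S' k) + (T' k - T k)) \<le> N (S k - S' k) + N (T' k - T k)"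
        by (intro triangle diff_mem cauchy_mem SD TD)
      moreover have "(S k - T k) - (S' k - T' k) = (S k - S' k) + (T' k - T k)" by simp
      moreover have "N (T' k - T k) = N (T k - T' k)"
        by (intro N_minus_commute cauchy_mem TD)
      ultimately show ?thesis by (simp only:)
    qed
    moreover have "0 \<le> N ((S k - T k) - (S' k - T' k))" for k
      by (intro N_nonneg diff_mem cauchy_mem[OF SD(1)] cauchy_mem[OF SD(2)]
          cauchy_mem[OF TD(1)] cauchy_mem[OF TD(2)])
    ultimately show "\<forall>k. norm (N ((S k - T k) - (S' k - T' k))) \<le> N (S k - S' k) + N (T k - T' k)"
      by simp
  qed
  then show ?thesis
    by (rule seq_equivI[OF cauchy_diff[OF SD(1) TD(1)] cauchy_diff[OF SD(2) TD(2)]])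
qed

lemma seq_equiv_equiv: "equiv (cauchy_seqs E ip) (seq_equiv E ip)"
proof (rule equivI)
  show "seq_equiv E ip \<subseteq> cauchy_seqs E ip \<times> cauchy_seqs E ip"
    by (auto simp: seq_equiv_def)
  show "refl_on (cauchy_seqs E ip) (seq_equiv E ip)"
    by (intro refl_onI seq_equivI) (simp_all add: N_zero)
  show "sym (seq_equiv E ip)"
  proof (rule symI)
    fix S T assume ST: "(S, T) \<in> seq_equiv E ip"
    note D = seq_equivD[OF ST]
    have "N (T k - S k) = N (S k - T k)" for k
      by (rule N_minus_commute[OF cauchy_mem[OF D(2)] cauchy_mem[OF D(1)]])
    then show "(T, S) \<in> seq_equiv E ip" using D(3) by (intro seq_equivI D) (simp only:)
  qed
  show "trans (seq_equiv E ip)"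
  proof (rule transI)
    fix R S T assume 1: "(R, S) \<in> seq_equiv E ip" and 2: "(S, T) \<in> seq_equiv E ip"
    note D1 = seq_equivD[OF 1] and D2 = seq_equivD[OF 2]
    have "N (R k - T k) \<le> N (R k - S k) + N (S k - T k)" for k
      using triangle[of "R k - S k" "S k - T k"]
      by (simp add: diff_mem cauchy_mem[OF D1(1)] cauchy_mem[OF D2(1)] cauchy_mem[OF D2(2)])
    moreover have "0 \<le> N (R k - T k)" for k
      by (intro N_nonneg diff_mem cauchy_mem[OF D1(1)] cauchy_mem[OF D2(2)])
    ultimately have "(\<lambda>k. N (R k - T k)) \<longlonglongrightarrow> 0"
      using tendsto_add[OF D1(3) D2(3)]
      by - (rule Lim_null_comparison[OF always_eventually, of _ "\<lambda>k. N (R k - S k) + N (S k - T k)"], simp_all)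
    then show "(R, T) \<in> seq_equiv E ip" by (rule seq_equivI[OF D1(1) D2(2)])
  qed
qed

abbreviation cls :: "(nat \<Rightarrow> 'e) \<Rightarrow> (nat \<Rightarrow> 'e) set" where "cls S \<equiv> seq_equiv E ip `` {S}"

lemma self_in_cls: "S \<in> cauchy_seqs E ip \<Longrightarrow> S \<in> cls S"
  using seq_equiv_equiv by (rule equiv_class_self)

lemma compl_diff_cls:
  assumes S: "S \<in> cauchy_seqs E ip" and T: "T \<in> cauchy_seqs E ip"
  shows "compl_diff E ip (cls S) (cls T) = cls (\<lambda>k. S k - T k)"
proof -
  have "cls (\<lambda>k. S' k - T' k) = cls (\<lambda>k. S k - T k)" if "S' \<in> cls S" "T' \<in> cls T" for S' T'
  proof -
    have "((\<lambda>k. S k - T k), (\<lambda>k. S' k - T' k)) \<in> seq_equiv E ip"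
      using that by (intro seq_equiv_diff) auto
    then show ?thesis by (rule equiv_class_eq[OF seq_equiv_equiv, symmetric])
  qed
  then have "compl_diff E ip (cls S) (cls T) = (\<Union>S'\<in>cls S. \<Union>T'\<in>cls T. cls (\<lambda>k. S k - T k))"
    unfolding compl_diff_def by (intro SUP_cong refl) auto
  then show ?thesis
    using self_in_cls[OF S] self_in_cls[OF T] by auto
qed

text \<open>The limit computed on one pair of representatives is the inner product in the
  completion, because replacing the representatives by equivalent ones changes the inner
  products by a null sequence.\<close>

lemma compl_ip_cls:
  assumes S: "S \<in> cauchy_seqs E ip" and T: "T \<in> cauchy_seqs E ip"
    and lim: "(\<lambda>k. ip (S k) (T k)) \<longlonglongrightarrow> c"
  shows "compl_ip ip (cls S) (cls T) = c"
  unfolding compl_ip_def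
proof (rule the_equality)
  show "\<exists>S'\<in>cls S. \<exists>T'\<in>cls T. (\<lambda>k. ip (S' k) (T' k)) \<longlonglongrightarrow> c"
    using lim self_in_cls[OF S] self_in_cls[OF T] by blast
next
  fix d assume "\<exists>S'\<in>cls S. \<exists>T'\<in>cls T. (\<lambda>k. ip (S' k) (T' k)) \<longlonglongrightarrow> d"
  then obtain S' T' where S': "(S, S') \<in> seq_equiv E ip" and T': "(T, T') \<in> seq_equiv E ip"
    and lim': "(\<lambda>k. ip (S' k) (T' k)) \<longlonglongrightarrow> d" by auto
  note SD = seq_equivD[OF S'] and TD = seq_equivD[OF T']
  obtain A where A: "A > 0" "\<And>k. N (S' k) \<le> A" using cauchy_bounded[OF SD(2)] by blast
  obtain B where B: "B > 0" "\<And>k. N (T k) \<le> B" using cauchy_bounded[OF T] by blast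
  have "cmod (ip (S k) (T k) - ip (S' k) (T' k)) \<le> N (S k - S' k) * B + A * N (T k - T' k)" for k
  proof -
    have "cmod (ip (S k) (T k) - ip (S' k) (T' k))
        \<le> N (S k - S' k) * N (T k) + N (S' k) * N (T k - T' k)"
      by (intro ip_diff_bound cauchy_mem SD TD)
    also have "\<dots> \<le> N (S k - S' k) * B + A * N (T k - T' k)"
      using A B by (intro add_mono mult_left_mono mult_right_mono N_nonneg diff_mem cauchy_mem SD TD)
    finally show ?thesis .
  qed
  moreover have "(\<lambda>k. N (S k - S' k) * B + A * N (T k - T' k)) \<longlonglongrightarrow> 0 * B + A * 0"
    by (intro tendsto_intros SD TD)
  ultimately have "(\<lambda>k. ip (S k) (T k) - ip (S' k) (T' k)) \<longlonglongrightarrow> 0"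
    by - (rule Lim_null_comparison[OF always_eventually,
        of _ "\<lambda>k. N (S k - S' k) * B + A * N (T k - T' k)"], simp_all)
  then show "d = c"
    using tendsto_diff[OF lim lim'] LIMSEQ_unique by fastforce
qed

section \<open>The Riesz representation theorem\<close>

text \<open>The sequence minimises \<open>J(x) = \<parallel>x\<parallel>\<^sup>2 - 2 Re L(x)\<close>, which equals
  \<open>\<parallel>x - v\<parallel>\<^sup>2 - \<parallel>v\<parallel>\<^sup>2\<close> if \<open>v\<close> represents \<open>L\<close>. The parallelogram law makes it Cauchy, and
  perturbing it in the direction \<open>x\<close> shows that it represents \<open>L\<close> asymptotically. The
  limit \<open>r\<close> is the squared norm of \<open>L\<close>.\<close>

lemma riesz_sequence:
  assumes L_add: "\<And>x y. x \<in> E \<Longrightarrow> y \<in> E \<Longrightarrow> L (x + y) = L x + L y"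
    and L_scaleC: "\<And>c x. x \<in> E \<Longrightarrow> L (c *\<^sub>C x) = c * L x"
    and L_bound: "\<And>x. x \<in> E \<Longrightarrow> (cmod (L x))\<^sup>2 \<le> K * (N x)\<^sup>2"
    and K: "K \<ge> 0"
  obtains s r where "s \<in> cauchy_seqs E ip" "\<And>x. x \<in> E \<Longrightarrow> (\<lambda>k. ip x (s k)) \<longlonglongrightarrow> L x"
    "(\<lambda>k. (N (s k))\<^sup>2) \<longlonglongrightarrow> r" "r \<le> K"
proof -
  define J where "J x = (N x)\<^sup>2 - 2 * Re (L x)" for x
  have J_lower: "- K \<le> J x" if x: "x \<in> E" for x
  proof -
    have "(2 * cmod (L x))\<^sup>2 \<le> 4 * (K * (N x)\<^sup>2)"
      using L_bound[OF x] by (simp add: power_mult_distrib)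
    also have "\<dots> \<le> (K + (N x)\<^sup>2)\<^sup>2"
      using zero_le_power2[of "K - (N x)\<^sup>2"] by (simp add: power2_eq_square algebra_simps)
    finally have "2 * cmod (L x) \<le> K + (N x)\<^sup>2"
      by (rule power2_le_imp_le) (simp add: K)
    then show ?thesis
      using complex_Re_le_cmod[of "L x"] by (simp add: J_def)
  qed
  define m where "m = Inf (J ` E)"
  have bdd: "bdd_below (J ` E)" using J_lower by (auto simp: bdd_below_def)
  have m_le: "m \<le> J x" if "x \<in> E" for x
    unfolding m_def using bdd that by (intro cInf_lower) auto
  have "\<exists>x\<in>E. J x < m + 1 / real (Suc k)" for k
    using cInf_lessD[of "J ` E" "m + 1 / real (Suc k)"] zero_mem by (auto simp: m_def)
  then obtain s where s: "\<And>k. s k \<in> E" and Js: "\<And>k. J (s k) < m + 1 / real (Suc k)"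
    by metis
  have close: "(N (s k - s l))\<^sup>2 \<le> 2 / real (Suc k) + 2 / real (Suc l)" for k l
  proof -
    let ?u = "(1/2) *\<^sub>C (s k + s l)"
    have "N ?u = 1/2 * N (s k + s l)" by (subst N_scaleC) (auto simp: s add_mem)
    then have "(N ?u)\<^sup>2 = (1/2 * N (s k + s l))\<^sup>2" by (rule arg_cong)
    then have "(N ?u)\<^sup>2 = 1/4 * (N (s k + s l))\<^sup>2" by (simp add: power_divide)
    then have "4 * J ?u = 2 * J (s k) + 2 * J (s l) - (N (s k - s l))\<^sup>2"
      by (simp add: J_def L_add L_scaleC s add_mem N_sq_add N_sq_diff add_divide_distrib)
    moreover have "m \<le> J ?u" by (intro m_le scaleC_mem add_mem s)
    ultimately show ?thesis using Js[of k] Js[of l] by simp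
  qed
  have sC: "s \<in> cauchy_seqs E ip"
  proof -
    have "\<exists>n. \<forall>k\<ge>n. \<forall>l\<ge>n. N (s k - s l) < e" if "e > 0" for e
    proof -
      obtain n where n: "inverse (real (Suc n)) < e\<^sup>2 / 4"
        using reals_Archimedean[of "e\<^sup>2 / 4"] \<open>e > 0\<close> by auto
      have "N (s k - s l) < e" if "k \<ge> n" "l \<ge> n" for k l
      proof (rule power2_less_imp_less)
        have "2 / real (Suc k) \<le> 2 / real (Suc n)" "2 / real (Suc l) \<le> 2 / real (Suc n)"
          using that by (auto intro!: divide_left_mono)
        moreover have "4 / real (Suc n) < e\<^sup>2" using n by (simp add: inverse_eq_divide)
        ultimately show "(N (s k - s l))\<^sup>2 < e\<^sup>2"
          using close[of k l] by simp
      qed (use \<open>e > 0\<close> in simp)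
      then show ?thesis by blast
    qed
    then show ?thesis using s by (auto simp: cauchy_seqs_def)
  qed
  have defect: "(cmod (ip x (s k) - L x))\<^sup>2 \<le> ((N x)\<^sup>2 + 1) / real (Suc k)" if x: "x \<in> E" for x k
  proof -
    define d where "d = ip x (s k) - L x"
    define t where "t = 1 / ((N x)\<^sup>2 + 1)"
    \<comment> \<open>The perturbation of \<open>s k\<close> along \<open>x\<close> in the direction in which \<open>J\<close> decreases fastest.\<close>
    define c where "c = - complex_of_real t * cnj d"
    have pos: "(N x)\<^sup>2 + 1 > 0" by (simp add: add_nonneg_pos)
    have t: "t > 0" "t * (N x)\<^sup>2 \<le> 1" using pos by (auto simp: t_def)
    have "J (s k + c *\<^sub>C x) = J (s k) + 2 * Re (c * d) + (cmod c)\<^sup>2 * (N x)\<^sup>2"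
    proof -
      have "ip (s k) (c *\<^sub>C x) = cnj (c * ip x (s k))"
        using x s by (simp add: scaleC_right hermitian[of x "s k"])
      then show ?thesis
        using x s by (simp add: J_def L_add L_scaleC scaleC_mem N_sq_add N_scaleC power_mult_distrib
            d_def algebra_simps)
    qed
    also have "Re (c * d) = - t * (cmod d)\<^sup>2"
      by (simp add: c_def cmod_power2) (simp add: algebra_simps power2_eq_square)
    also have "(cmod c)\<^sup>2 = t\<^sup>2 * (cmod d)\<^sup>2"
      by (simp add: c_def norm_mult power_mult_distrib)
    finally have "m \<le> J (s k) + 2 * (- t * (cmod d)\<^sup>2) + t\<^sup>2 * (cmod d)\<^sup>2 * (N x)\<^sup>2"
      using m_le[of "s k + c *\<^sub>C x"] x s by (simp add: add_mem scaleC_mem)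
    moreover have "t\<^sup>2 * (cmod d)\<^sup>2 * (N x)\<^sup>2 \<le> t * (cmod d)\<^sup>2"
    proof -
      have "t\<^sup>2 * (cmod d)\<^sup>2 * (N x)\<^sup>2 = (t * (cmod d)\<^sup>2) * (t * (N x)\<^sup>2)"
        by (simp add: power2_eq_square)
      also have "\<dots> \<le> t * (cmod d)\<^sup>2"
        using t by (intro mult_right_le_one_le) auto
      finally show ?thesis .
    qed
    ultimately have "t * (cmod d)\<^sup>2 \<le> 1 / real (Suc k)"
      using Js[of k] by linarith
    then show ?thesis
      using pos unfolding d_def[symmetric] t_def by (simp add: field_simps)
  qed
  have lim: "(\<lambda>k. ip x (s k)) \<longlonglongrightarrow> L x" if x: "x \<in> E" for x
  proof -
    have "(\<lambda>k. ((N x)\<^sup>2 + 1) / real (Suc k)) \<longlonglongrightarrow> 0"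
      using LIMSEQ_Suc[OF lim_const_over_n] .
    moreover have "\<forall>k. norm ((cmod (ip x (s k) - L x))\<^sup>2) \<le> ((N x)\<^sup>2 + 1) / real (Suc k)"
      using defect[OF x] by (simp only: real_norm_def abs_power2 simp_thms)
    ultimately have "(\<lambda>k. (cmod (ip x (s k) - L x))\<^sup>2) \<longlonglongrightarrow> 0"
      by (rule Lim_null_comparison[OF always_eventually, rotated])
    then have "(\<lambda>k. sqrt ((cmod (ip x (s k) - L x))\<^sup>2)) \<longlonglongrightarrow> sqrt 0"
      by (intro tendsto_real_sqrt)
    then show ?thesis
      by - (rule LIM_zero_cancel, simp add: tendsto_norm_zero_iff)
  qed
  \<comment> \<open>Since \<open>\<parallel>s k\<parallel>\<close> is bounded, the estimate \<open>defect\<close> is uniform along \<open>x = s k\<close>. So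
    \<open>L (s k)\<close> and \<open>\<parallel>s k\<parallel>\<^sup>2\<close> have the same limit \<open>r\<close>, and the bound on \<open>L\<close> becomes
    \<open>r\<^sup>2 \<le> K r\<close>.\<close>
  obtain B where B: "B > 0" "\<And>k. N (s k) \<le> B" using cauchy_bounded[OF sC] by blast
  obtain w where w: "(\<lambda>k. ip (s k) (s k)) \<longlonglongrightarrow> w"
    using ip_convergent[OF sC sC] by (auto simp: convergent_def)
  define r where "r = Re w"
  have r: "(\<lambda>k. (N (s k))\<^sup>2) \<longlonglongrightarrow> r"
    using tendsto_Re[OF w] by (simp add: r_def N_sq s)
  have "(\<lambda>k. (cmod (ip (s k) (s k) - L (s k)))\<^sup>2) \<longlonglongrightarrow> 0"
  proof (rule Lim_null_comparison[OF always_eventually])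
    show "(\<lambda>k. (B\<^sup>2 + 1) / real (Suc k)) \<longlonglongrightarrow> 0"
      using LIMSEQ_Suc[OF lim_const_over_n] .
    have "(cmod (ip (s k) (s k) - L (s k)))\<^sup>2 \<le> (B\<^sup>2 + 1) / real (Suc k)" for k
    proof -
      have "(N (s k))\<^sup>2 \<le> B\<^sup>2" by (intro power_mono B N_nonneg s)
      then have "((N (s k))\<^sup>2 + 1) / real (Suc k) \<le> (B\<^sup>2 + 1) / real (Suc k)"
        by (intro divide_right_mono) auto
      then show ?thesis using defect[OF s[of k], of k] by linarith
    qed
    then show "\<forall>k. norm ((cmod (ip (s k) (s k) - L (s k)))\<^sup>2) \<le> (B\<^sup>2 + 1) / real (Suc k)" by simp
  qed
  then have "(\<lambda>k. sqrt ((cmod (ip (s k) (s k) - L (s k)))\<^sup>2)) \<longlonglongrightarrow> sqrt 0"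
    by (intro tendsto_real_sqrt)
  then have "(\<lambda>k. ip (s k) (s k) - L (s k)) \<longlonglongrightarrow> 0"
    by (simp add: tendsto_norm_zero_iff)
  then have "(\<lambda>k. L (s k)) \<longlonglongrightarrow> w"
    using tendsto_diff[OF w] by fastforce
  then have "(\<lambda>k. (cmod (L (s k)))\<^sup>2) \<longlonglongrightarrow> (cmod w)\<^sup>2"
    by (intro tendsto_intros)
  moreover have "(\<lambda>k. K * (N (s k))\<^sup>2) \<longlonglongrightarrow> K * r" by (intro tendsto_intros r)
  ultimately have "(cmod w)\<^sup>2 \<le> K * r"
    by (rule LIMSEQ_le) (auto simp: L_bound s)
  moreover have "r\<^sup>2 \<le> (cmod w)\<^sup>2"
    using abs_Re_le_cmod[of w] by (simp add: r_def power2_le_iff_abs_le)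
  moreover have "0 \<le> r" using r by (rule LIMSEQ_le_const) auto
  ultimately have "r * r \<le> K * r" "0 \<le> r"
    by (simp_all add: power2_eq_square)
  then have "r \<le> K"
    using K by (cases "r = 0") simp_all
  then show ?thesis using that[OF sC lim r] by blast
qed

end

text \<open>Applied to the map \<open>P \<mapsto> [\<J>P](X)\<close>.\<close>

lemma psd_form_pullback:
  fixes f :: "'a::complex_vector \<Rightarrow> 'e::complex_vector"
  assumes "psd_form E ip"
    and "\<And>x. f x \<in> E" "\<And>x y. f (x + y) = f x + f y" "\<And>c x. f (c *\<^sub>C x) = c *\<^sub>C f x"
  shows "psd_form UNIV (\<lambda>x y. ip (f x) (f y))"
proof -
  interpret psd_form E ip by fact
  show ?thesis
    by standard (simp_all add: assms add_left add_right scaleC_left scaleC_right nonneg)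
qed

instantiation vec :: (complex_vector, finite) complex_vector
begin

definition scaleC_vec_def: "c *\<^sub>C x = (\<chi> i. c *\<^sub>C x $ i)"

instance
  by standard (simp_all add: scaleC_vec_def vec_eq_iff scaleC_add_right scaleC_add_left
      scaleC_scaleC scaleC_one)

end

lemma scaleC_vec_component [simp]: "(c *\<^sub>C x) $ i = c *\<^sub>C x $ i"
  by (simp add: scaleC_vec_def)

lemma nonneg_Reals_sum:
  fixes f :: "'i \<Rightarrow> complex"
  assumes "\<And>i. i \<in> I \<Longrightarrow> f i \<in> \<real>\<^sub>\<ge>\<^sub>0"
  shows "sum f I \<in> \<real>\<^sub>\<ge>\<^sub>0"
  using assms by (induction I rule: infinite_finite_induct) (auto simp: nonneg_Reals_add_I)

lemma psd_form_vec:
  assumes "psd_form E ip"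
  shows "psd_form {x :: 'e::complex_vector ^ 'n. \<forall>i. x $ i \<in> E} (\<lambda>x y. \<Sum>i\<in>UNIV. ip (x $ i) (y $ i))"
proof -
  interpret psd_form E ip by fact
  show ?thesis
    by standard (auto simp: add_left add_right scaleC_left scaleC_right nonneg sum.distrib
        sum_distrib_left zero_mem add_mem scaleC_mem intro!: nonneg_Reals_sum)
qed

section \<open>The Schur product theorem for Gram matrices\<close>

text \<open>Induction on the index set. Subtracting from each \<open>b k\<close> its component along a chosen
  vector \<open>b x\<close> makes row and column \<open>x\<close> of the second Gram matrix vanish, at the cost of a
  rank one matrix with entries \<open>\<beta> c\<^sub>k cnj(c\<^sub>l)\<close>. The latter contributes
  \<open>\<beta> f(u, u) \<ge> 0\<close> with \<open>u = \<Sum>\<^sub>k c\<^sub>k a\<^sub>k\<close>.\<close>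

lemma schur_product_nonneg:
  assumes f: "psd_form E f" and g: "psd_form D g"
    and fin: "finite I" and a: "\<And>k. k \<in> I \<Longrightarrow> a k \<in> E" and b: "\<And>k. k \<in> I \<Longrightarrow> b k \<in> D"
  shows "(\<Sum>k\<in>I. \<Sum>l\<in>I. f (a k) (a l) * g (b k) (b l)) \<in> \<real>\<^sub>\<ge>\<^sub>0"
  using fin a b
proof (induction I arbitrary: b rule: finite_induct)
  case empty
  show ?case by simp
next
  case (insert x I)
  interpret f: psd_form E f by fact
  interpret g: psd_form D g by fact
  let ?J = "insert x I"
  have a: "\<And>k. k \<in> ?J \<Longrightarrow> a k \<in> E" and b: "\<And>k. k \<in> ?J \<Longrightarrow> b k \<in> D"
    using insert.prems by auto
  have bx: "b x \<in> D" using b by simp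
  define \<beta> where "\<beta> = g (b x) (b x)"
  \<comment> \<open>If \<open>\<beta> = 0\<close>, division by zero gives \<open>c = 0\<close>, and row \<open>x\<close> vanishes already by the
    Cauchy-Schwarz inequality.\<close>
  define c where "c k = g (b k) (b x) / \<beta>" for k
  define b' where "b' k = b k - c k *\<^sub>C b x" for k
  have b': "b' k \<in> D" if "k \<in> ?J" for k
    unfolding b'_def using that by (intro g.diff_mem g.scaleC_mem b bx)
  have zero: "g (b x) y = 0" if "\<beta> = 0" "y \<in> D" for y
    using g.cauchy_schwarz[OF bx \<open>y \<in> D\<close>] that g.self_eq[OF bx] by (simp add: \<beta>_def)
  have cnj_c: "\<beta> * cnj (c l) = g (b x) (b l)" if "l \<in> ?J" for l
  proof (cases "\<beta> = 0")
    case True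
    then show ?thesis using zero b that by simp
  next
    case False
    have "cnj \<beta> = \<beta>" unfolding \<beta>_def using g.hermitian[OF bx bx] by simp
    then show ?thesis
      using False g.hermitian[OF b[OF that] bx] by (simp add: c_def)
  qed
  have c_beta: "c k * \<beta> = g (b k) (b x)" if "k \<in> ?J" for k
    using arg_cong[OF cnj_c[OF that], of cnj] g.hermitian[OF bx b[OF that]]
      g.hermitian[OF bx bx] by (simp add: \<beta>_def mult.commute)
  have split: "g (b k) (b l) = g (b' k) (b' l) + \<beta> * (c k * cnj (c l))"
    if k: "k \<in> ?J" and l: "l \<in> ?J" for k l
  proof -
    have "g (b' k) (b' l) = g (b k) (b l) - cnj (c l) * g (b k) (b x) - c k * g (b x) (b l)
        + c k * cnj (c l) * \<beta>"
      unfolding b'_def \<beta>_def using b[OF k] b[OF l] bx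
      by (simp add: g.diff_left g.diff_right g.scaleC_left g.scaleC_right g.scaleC_mem g.diff_mem
          algebra_simps)
    then show ?thesis
      unfolding c_beta[OF k, symmetric] cnj_c[OF l, symmetric] by (simp add: algebra_simps)
  qed
  have bx0: "g (b' x) y = 0" "g y (b' x) = 0" if "y \<in> D" for y
  proof -
    have "g (b' x) y = g (b x) y - c x * g (b x) y"
      unfolding b'_def using bx that by (simp add: g.diff_left g.scaleC_left g.scaleC_mem)
    also have "\<dots> = 0"
      using zero[OF _ that] by (cases "\<beta> = 0") (simp_all add: c_def \<beta>_def)
    finally show "g (b' x) y = 0" .
    then show "g y (b' x) = 0"
      using g.hermitian[OF b'[of x] that] by simp
  qed
  have "(\<Sum>k\<in>?J. \<Sum>l\<in>?J. f (a k) (a l) * g (b k) (b l))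
      = (\<Sum>k\<in>?J. \<Sum>l\<in>?J. f (a k) (a l) * g (b' k) (b' l))
        + \<beta> * (\<Sum>k\<in>?J. \<Sum>l\<in>?J. c k * cnj (c l) * f (a k) (a l))"
    unfolding sum_distrib_left sum.distrib[symmetric]
    by (intro sum.cong refl) (simp add: split algebra_simps)
  also have "(\<Sum>k\<in>?J. \<Sum>l\<in>?J. f (a k) (a l) * g (b' k) (b' l))
      = (\<Sum>k\<in>I. \<Sum>l\<in>I. f (a k) (a l) * g (b' k) (b' l))"
    using insert.hyps by (simp add: bx0 b')
  also have "(\<Sum>k\<in>?J. \<Sum>l\<in>?J. c k * cnj (c l) * f (a k) (a l))
      = f (\<Sum>k\<in>?J. c k *\<^sub>C a k) (\<Sum>k\<in>?J. c k *\<^sub>C a k)"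
    by (subst f.ip_sum) (use a f.scaleC_mem f.scaleC_left f.scaleC_right in \<open>auto simp: algebra_simps\<close>)
  finally have eq: "(\<Sum>k\<in>?J. \<Sum>l\<in>?J. f (a k) (a l) * g (b k) (b l))
      = (\<Sum>k\<in>I. \<Sum>l\<in>I. f (a k) (a l) * g (b' k) (b' l))
        + \<beta> * f (\<Sum>k\<in>?J. c k *\<^sub>C a k) (\<Sum>k\<in>?J. c k *\<^sub>C a k)" .
  have "(\<Sum>k\<in>I. \<Sum>l\<in>I. f (a k) (a l) * g (b' k) (b' l)) \<in> \<real>\<^sub>\<ge>\<^sub>0"
    by (rule insert.IH) (use a b' in auto)
  moreover have "\<beta> * f (\<Sum>k\<in>?J. c k *\<^sub>C a k) (\<Sum>k\<in>?J. c k *\<^sub>C a k) \<in> \<real>\<^sub>\<ge>\<^sub>0"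
    unfolding \<beta>_def
    by (intro nonneg_Reals_mult_I g.nonneg f.nonneg bx f.sum_mem) (use a f.scaleC_mem in auto)
  ultimately show ?case
    unfolding eq by (rule nonneg_Reals_add_I)
qed

section \<open>Adjoints of bounded operators\<close>

lemma cinner_add_right: "cinner x (y + z) = cinner x y + cinner x (z :: 'h::chilbert_space)"
  by (simp add: cinner_commute[of x] cinner_add_left)

lemma cinner_scaleC_right: "cinner x (c *\<^sub>C y) = cnj c * cinner x (y :: 'h::chilbert_space)"
  by (simp add: cinner_commute[of x] cinner_scaleC_left)

lemma cinner_self: "cinner x x = complex_of_real ((norm (x :: 'h::chilbert_space))\<^sup>2)"
proof -
  have "Im (cinner x x) = 0"
    using arg_cong[OF cinner_commute[of x x], of Im] by simp
  then show ?thesis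
    by (simp add: complex_eq_iff Re_cinner power2_norm_eq_inner)
qed

interpretation hilbert: psd_form "UNIV :: 'h::chilbert_space set" cinner
  by standard (simp_all add: cinner_add_left cinner_add_right cinner_scaleC_left
      cinner_scaleC_right cinner_self)

lemma ip_norm_cinner: "ip_norm cinner (x :: 'h::chilbert_space) = norm x"
  by (simp add: ip_norm_def cinner_self)

lemma cinner_diff_left: "cinner (x - y) z = cinner x z - cinner y (z :: 'h::chilbert_space)"
  by (simp add: hilbert.diff_left)

lemma cinner_diff_right: "cinner z (x - y) = cinner z x - cinner z (y :: 'h::chilbert_space)"
  by (simp add: hilbert.diff_right)

lemma cinner_cauchy_schwarz: "cmod (cinner x y) \<le> norm x * norm (y :: 'h::chilbert_space)"
  using hilbert.cauchy_schwarz[of x y] by (simp add: ip_norm_cinner)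

lemma cinner_extensionality:
  fixes x y :: "'h::chilbert_space"
  assumes "\<And>z. cinner z x = cinner z y"
  shows "x = y"
  using assms[of "x - y"] cinner_self[of "x - y"] by (simp add: cinner_diff_right)

lemma riesz_representation:
  fixes L :: "'h::chilbert_space \<Rightarrow> complex"
  assumes "\<And>x y. L (x + y) = L x + L y" "\<And>c x. L (c *\<^sub>C x) = c * L x"
    and bound: "\<And>x. cmod (L x) \<le> K * norm x"
  shows "\<exists>z. \<forall>x. L x = cinner x z"
proof -
  have sq: "(cmod (L x))\<^sup>2 \<le> K\<^sup>2 * (ip_norm cinner x)\<^sup>2" for x
    using power_mono[OF bound[of x], of 2] by (simp add: power_mult_distrib ip_norm_cinner)
  then obtain s r where s: "s \<in> cauchy_seqs UNIV cinner"
    and lim: "\<And>x. (\<lambda>k. cinner x (s k)) \<longlonglongrightarrow> L x"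
    using hilbert.riesz_sequence[of L "K\<^sup>2", OF assms(1,2) sq zero_le_power2] by (metis UNIV_I)
  have "Cauchy s"
    unfolding Cauchy_def dist_norm using s by (simp add: cauchy_seqs_def ip_norm_cinner)
  then obtain z where z: "s \<longlonglongrightarrow> z"
    using Cauchy_convergent convergent_def by blast
  have "(\<lambda>k. cinner x (s k)) \<longlonglongrightarrow> cinner x z" for x
  proof (rule LIM_zero_cancel, rule Lim_null_comparison[OF always_eventually])
    show "\<forall>k. norm (cinner x (s k) - cinner x z) \<le> norm x * norm (s k - z)"
      using cinner_cauchy_schwarz by (auto simp: cinner_diff_right[symmetric])
    show "(\<lambda>k. norm x * norm (s k - z)) \<longlonglongrightarrow> 0"
      using z by (intro tendsto_mult_right_zero) (simp add: LIM_zero tendsto_norm_zero)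
  qed
  then show ?thesis
    using lim LIMSEQ_unique by blast
qed

lemma bop_apply_bound:
  obtains K where "K \<ge> 0" "\<And>x. norm (bop_apply a x) \<le> K * norm x"
proof -
  have "bounded_linear (bop_apply a)" using bop_apply[of a] by simp
  then show ?thesis
    using bounded_linear.nonneg_bounded that by (metis mult.commute)
qed

lemma bop_apply_linear:
  "bop_apply a (x + y) = bop_apply a x + bop_apply a y"
  "bop_apply a (c *\<^sub>C x) = c *\<^sub>C bop_apply a x"
  using bop_apply[of a] by (auto simp: linear_add bounded_linear.linear)

lemma adjoint_exists:
  fixes a :: "'h::chilbert_space bop"
  shows "\<exists>b. \<forall>x y. cinner (bop_apply a x) y = cinner x (bop_apply b y)"
proof -
  obtain K where K: "K \<ge> 0" "\<And>x. norm (bop_apply a x) \<le> K * norm x"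
    using bop_apply_bound by blast
  have bd: "cmod (cinner (bop_apply a x) y) \<le> (K * norm y) * norm x" for x y
  proof -
    have "cmod (cinner (bop_apply a x) y) \<le> norm (bop_apply a x) * norm y"
      by (rule cinner_cauchy_schwarz)
    also have "\<dots> \<le> (K * norm x) * norm y"
      by (intro mult_right_mono K) auto
    finally show ?thesis by (simp add: ac_simps)
  qed
  have "\<exists>z. \<forall>x. cinner (bop_apply a x) y = cinner x z" for y
    by (rule riesz_representation[OF _ _ bd])
      (simp_all add: bop_apply_linear cinner_add_left cinner_scaleC_left)
  then obtain f where f: "\<And>x y. cinner (bop_apply a x) y = cinner x (f y)"
    by metis
  have f_add: "f (y + z) = f y + f z" for y z
    by (rule cinner_extensionality) (simp add: f[symmetric] cinner_add_right)
  have f_scaleC: "f (c *\<^sub>C y) = c *\<^sub>C f y" for c y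
    by (rule cinner_extensionality) (simp add: f[symmetric] cinner_scaleC_right)
  have f_bound: "norm (f y) \<le> norm y * K" for y
  proof (cases "f y = 0")
    case False
    have "(norm (f y))\<^sup>2 = cmod (cinner (bop_apply a (f y)) y)"
      unfolding f cinner_self by (simp only: norm_of_real abs_power2)
    also have "\<dots> \<le> (K * norm y) * norm (f y)" by (rule bd)
    finally show ?thesis
      using False by (simp add: power2_eq_square mult.commute)
  qed (simp add: K)
  have "bounded_linear f"
    by (rule bounded_linear_intro[OF f_add _ f_bound]) (simp add: scaleR_scaleC f_scaleC)
  then have "bop_apply (Abs_bop f) = f"
    by (intro Abs_bop_inverse) (simp add: f_scaleC)
  then show ?thesis using f by (intro exI[of _ "Abs_bop f"]) simp
qed

lemma adjoint_unique:
  assumes "\<And>x y. cinner (bop_apply a x) y = cinner x (bop_apply b y)"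
    and "\<And>x y. cinner (bop_apply a x) y = cinner x (bop_apply c y)"
  shows "b = c"
  by (rule bop_eqI, rule cinner_extensionality) (simp add: assms[symmetric])

lemma cinner_adj: "cinner (bop_apply a x) y = cinner x (bop_apply (adj a) y)"
proof -
  obtain b where b: "\<forall>x y. cinner (bop_apply a x) y = cinner x (bop_apply b y)"
    using adjoint_exists by blast
  have "\<forall>x y. cinner (bop_apply a x) y = cinner x (bop_apply (adj a) y)"
    unfolding adj_def using b by (rule theI) (use b adjoint_unique in blast)
  then show ?thesis by blast
qed

lemma adj_eqI: "(\<And>x y. cinner (bop_apply a x) y = cinner x (bop_apply b y)) \<Longrightarrow> adj a = b"
  using adjoint_unique cinner_adj by blast

lemma cinner_adj': "cinner (bop_apply (adj a) x) y = cinner x (bop_apply a y)"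
  using cinner_adj[of a y x] by (simp add: cinner_commute[of "bop_apply (adj a) x"] cinner_commute[of x])

lemmas bop_apply_simps = zero_bop.rep_eq one_bop.rep_eq plus_bop.rep_eq minus_bop.rep_eq
  uminus_bop.rep_eq times_bop.rep_eq scaleC_bop.rep_eq

lemma adj_adj [simp]: "adj (adj a) = a"
  by (rule adj_eqI) (rule cinner_adj')

lemma adj_one [simp]: "adj 1 = (1 :: 'h::chilbert_space bop)"
  by (rule adj_eqI) (simp add: bop_apply_simps)

lemma adj_add: "adj (a + b) = adj a + adj b"
  by (rule adj_eqI) (simp add: bop_apply_simps cinner_add_left cinner_add_right cinner_adj)

lemma adj_scaleC: "adj (c *\<^sub>C a) = cnj c *\<^sub>C adj a"
  by (rule adj_eqI)
    (simp add: bop_apply_simps cinner_scaleC_left cinner_scaleC_right cinner_adj)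

lemma adj_mult: "adj (a * b) = adj b * adj a"
  by (rule adj_eqI) (simp add: bop_apply_simps cinner_adj)

lemma bop_scaleC_mult:
  fixes a b :: "'h::chilbert_space bop"
  shows "(c *\<^sub>C a) * b = c *\<^sub>C (a * b)" "a * (c *\<^sub>C b) = c *\<^sub>C (a * b)"
  by (rule bop_eqI, simp add: bop_apply_simps bop_apply_linear)+

lemma positive_sandwich:
  assumes "positive_bop p"
  shows "positive_bop (w * p * adj w)"
  using assms unfolding positive_bop_def
  by (simp add: bop_apply_simps cinner_adj[of w])

lemma positive_one: "positive_bop 1"
  by (simp add: positive_bop_def bop_apply_simps cinner_self)

text \<open>The boundedness of \<open>x\<close>, in a form to which a state can be applied.\<close>

lemma positive_dominating_scalar:
  fixes x :: "'h::chilbert_space bop"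
  obtains K :: real where "K \<ge> 0"
    "positive_bop (complex_of_real K *\<^sub>C 1 - adj x * x)"
proof -
  obtain B where B: "B \<ge> 0" "\<And>v. norm (bop_apply x v) \<le> B * norm v"
    using bop_apply_bound by blast
  have "(norm (bop_apply x v))\<^sup>2 \<le> B\<^sup>2 * (norm v)\<^sup>2" for v
    using power_mono[OF B(2)[of v], of 2] by (simp add: power_mult_distrib)
  moreover have "cinner (bop_apply (complex_of_real (B\<^sup>2) *\<^sub>C 1 - adj x * x) v) v
      = complex_of_real (B\<^sup>2 * (norm v)\<^sup>2 - (norm (bop_apply x v))\<^sup>2)" for v
    by (simp add: bop_apply_simps cinner_diff_left cinner_scaleC_left cinner_adj' cinner_self)
  ultimately have "positive_bop (complex_of_real (B\<^sup>2) *\<^sub>C 1 - adj x * x)"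
    unfolding positive_bop_def by (simp only: nonneg_Reals_of_real_iff diff_ge_0_iff_ge simp_thms)
  then show ?thesis using that[of "B\<^sup>2"] by simp
qed

section \<open>The algebraic tensor product\<close>

text \<open>A state on \<open>M\<close> is extended to a linear functional on all operators, because tensors are
  classes modulo bilinearity relations that involve arbitrary operators.\<close>

lemma linear_functional_extension:
  fixes f :: "'a::complex_vector \<Rightarrow> complex"
  assumes S: "0 \<in> S" "\<And>x y. x \<in> S \<Longrightarrow> y \<in> S \<Longrightarrow> x + y \<in> S" "\<And>c x. x \<in> S \<Longrightarrow> c *\<^sub>C x \<in> S"
    and f: "\<And>x y. x \<in> S \<Longrightarrow> y \<in> S \<Longrightarrow> f (x + y) = f x + f y" "\<And>c x. x \<in> S \<Longrightarrow> f (c *\<^sub>C x) = c * f x"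
  obtains g where "\<And>x y. g (x + y) = g x + g y" "\<And>c x. g (c *\<^sub>C x) = c * g x"
    "\<And>x. x \<in> S \<Longrightarrow> g x = f x"
proof -
  interpret V: vector_space "scaleC :: complex \<Rightarrow> 'a \<Rightarrow> 'a"
    by standard (simp_all add: scaleC_add_right scaleC_add_left scaleC_scaleC scaleC_one)
  interpret C: vector_space "(*) :: complex \<Rightarrow> complex \<Rightarrow> complex"
    by standard (simp_all add: algebra_simps)
  interpret P: vector_space_pair "scaleC :: complex \<Rightarrow> 'a \<Rightarrow> 'a" "(*) :: complex \<Rightarrow> complex \<Rightarrow> complex" ..
  obtain B where B: "B \<subseteq> S" "V.independent B" "S \<subseteq> V.span B"
    using V.maximal_independent_subset[of S] by blast
  obtain g where g: "Vector_Spaces.linear scaleC (*) g" "\<forall>x\<in>B. g x = f x"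
    using P.linear_independent_extend[OF B(2)] by blast
  interpret g: Vector_Spaces.linear scaleC "(*)" g by fact
  have f0: "f 0 = 0" using f(2)[OF S(1), of 0] by simp
  have "V.span B \<subseteq> {x \<in> S. g x = f x}"
    by (rule V.span_minimal)
      (use B g S f in \<open>auto simp: V.subspace_def g.add g.scale g.zero f0\<close>)
  then show ?thesis
    using that[of g] B(3) g.add g.scale by blast
qed

lemma abs_tensor_eq: "abs_tensor F = free_lift (\<lambda>(a, b). a \<otimes> b) F"
proof -
  have 1: "abs_tensor (Poly_Mapping.single k c) = c *\<^sub>C (fst k \<otimes> snd k)" for k :: "'a \<times> 'b" and c
    by (cases k) (simp add: tens.abs_eq scaleC_tensor.abs_eq scaleC_single)
  show ?thesis
  proof (induction F rule: Poly_Mapping.update_induct)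
    case const
    then show ?case by (simp add: free_lift_def zero_tensor.abs_eq[symmetric])
  next
    case (update F k c)
    have "Poly_Mapping.update k c F = Poly_Mapping.single k c + F"
      using update(1) by (intro poly_mapping_eqI)
        (auto simp: update.rep_eq lookup_add lookup_single in_keys_iff when_def)
    then show ?case
      using update(3) by (simp add: plus_tensor.abs_eq[symmetric] 1 free_lift_add free_lift_single
          case_prod_beta)
  qed
qed

lemma tensor_span_zero: "0 \<in> tensor_span S T"
  unfolding tensor_span_def zero_tensor_def by (intro CollectI exI[of _ 0]) simp

lemma tensor_span_add:
  assumes "y \<in> tensor_span S T" "z \<in> tensor_span S T"
  shows "y + z \<in> tensor_span S T"
proof -
  obtain F G where "Poly_Mapping.keys F \<subseteq> S \<times> T" "y = abs_tensor F"
    "Poly_Mapping.keys G \<subseteq> S \<times> T" "z = abs_tensor G"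
    using assms by (auto simp: tensor_span_def)
  then show ?thesis
    unfolding tensor_span_def using Poly_Mapping.keys_add[of F G]
    by (intro CollectI exI[of _ "F + G"]) (auto simp: plus_tensor.abs_eq)
qed

lemma tensor_span_scaleC:
  assumes "z \<in> tensor_span S T"
  shows "c *\<^sub>C z \<in> tensor_span S T"
proof -
  obtain F where F: "Poly_Mapping.keys F \<subseteq> S \<times> T" "z = abs_tensor F"
    using assms by (auto simp: tensor_span_def)
  have "Poly_Mapping.keys (c *\<^sub>C F) \<subseteq> Poly_Mapping.keys F"
    by (auto simp: in_keys_iff scaleC_poly_mapping.rep_eq)
  then show ?thesis
    unfolding tensor_span_def using F
    by (intro CollectI exI[of _ "c *\<^sub>C F"]) (auto simp: scaleC_tensor.abs_eq)
qed

lemma tensor_span_tens: "a \<in> S \<Longrightarrow> b \<in> T \<Longrightarrow> a \<otimes> b \<in> tensor_span S T"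
  unfolding tensor_span_def tens.abs_eq
  by (intro CollectI exI[of _ "pure_pair a b"]) simp

lemma tensor_span_sum: "(\<And>k. k \<in> I \<Longrightarrow> f k \<in> tensor_span S T) \<Longrightarrow> sum f I \<in> tensor_span S T"
  by (induction I rule: infinite_finite_induct) (auto simp: tensor_span_zero tensor_span_add)

lemma tensor_spanE:
  fixes z :: "('a::complex_vector, 'b::complex_vector) tensor"
  assumes "z \<in> tensor_span S T" "\<And>c a. a \<in> S \<Longrightarrow> c *\<^sub>C a \<in> S"
  obtains I :: "('a \<times> 'b) set" and a b
  where "finite I" "\<And>k. k \<in> I \<Longrightarrow> a k \<in> S" "\<And>k. k \<in> I \<Longrightarrow> b k \<in> T" "z = (\<Sum>k\<in>I. a k \<otimes> b k)"
proof -
  obtain F where F: "Poly_Mapping.keys F \<subseteq> S \<times> T" "z = abs_tensor F"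
    using assms by (auto simp: tensor_span_def)
  show ?thesis
  proof (rule that[of "Poly_Mapping.keys F" "\<lambda>k. Poly_Mapping.lookup F k *\<^sub>C fst k" snd])
    show "z = (\<Sum>k\<in>Poly_Mapping.keys F. (Poly_Mapping.lookup F k *\<^sub>C fst k) \<otimes> snd k)"
      by (simp add: F(2) abs_tensor_eq free_lift_def tens_linear case_prod_beta)
  qed (use F assms in auto)
qed

lemma tensor_lift_sum:
  assumes "cbilinear f"
  shows "tensor_lift f (\<Sum>k\<in>I. g k) = (\<Sum>k\<in>I. tensor_lift f (g k))"
proof -
  have "tensor_lift f 0 = 0" using tensor_lift_scaleC[OF assms, of 0 0] by simp
  then show ?thesis
    by (induction I rule: infinite_finite_induct) (simp_all add: tensor_lift_add assms)
qed

lemma op_mult_inner_cbilinear: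
  fixes a b :: "'h::chilbert_space bop"
  shows "cbilinear (\<lambda>c d. (a * c) \<otimes> (d * b))"
  by (simp add: cbilinear_def tens_linear distrib_left distrib_right bop_scaleC_mult)

lemma op_mult_outer_cbilinear:
  fixes z :: "('h::chilbert_space bop, 'h bop) tensor"
  shows "cbilinear (\<lambda>a b. tensor_lift (\<lambda>c d. (a * c) \<otimes> (d * b)) z)"
  unfolding cbilinear_def tensor_lift_def free_lift_def
  by (simp add: tens_linear distrib_left distrib_right bop_scaleC_mult scaleC_add_right
      sum.distrib scaleC_sum_right scaleC_scaleC mult.commute case_prod_beta)

lemma op_mult_tens:
  fixes a b c d :: "'h::chilbert_space bop"
  shows "op_mult (a \<otimes> b) (c \<otimes> d) = (a * c) \<otimes> (d * b)"
  unfolding op_mult_def tensor_lift_tens[OF op_mult_outer_cbilinear]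
  by (rule tensor_lift_tens[OF op_mult_inner_cbilinear])

lemma op_mult_linear_left:
  "op_mult (y + y') z = op_mult y z + op_mult y' z" "op_mult (c *\<^sub>C y) z = c *\<^sub>C op_mult y z"
  by (simp_all add: op_mult_def tensor_lift_add tensor_lift_scaleC op_mult_outer_cbilinear)

lemma op_mult_linear_right:
  "op_mult y (z + z') = op_mult y z + op_mult y z'" "op_mult y (c *\<^sub>C z) = c *\<^sub>C op_mult y z"
  unfolding op_mult_def
  by (simp_all add: tensor_lift_add tensor_lift_scaleC op_mult_inner_cbilinear)
     (simp_all add: tensor_lift_def free_lift_def scaleC_add_right sum.distrib scaleC_sum_right
       scaleC_scaleC mult_ac case_prod_beta)

lemma op_mult_sum:
  "op_mult (\<Sum>k\<in>I. f k) z = (\<Sum>k\<in>I. op_mult (f k) z)"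
  "op_mult y (\<Sum>k\<in>I. f k) = (\<Sum>k\<in>I. op_mult y (f k))"
proof -
  have zero: "op_mult 0 z = 0" "op_mult y 0 = 0" for y z
    using op_mult_linear_left(2)[of 0 0 z] op_mult_linear_right(2)[of y 0 0] by simp_all
  show "op_mult (\<Sum>k\<in>I. f k) z = (\<Sum>k\<in>I. op_mult (f k) z)"
    by (induction I rule: infinite_finite_induct) (simp_all add: zero op_mult_linear_left)
  show "op_mult y (\<Sum>k\<in>I. f k) = (\<Sum>k\<in>I. op_mult y (f k))"
    by (induction I rule: infinite_finite_induct) (simp_all add: zero op_mult_linear_right)
qed

text \<open>The antilinear analogue of \<open>free_lift\<close> for the involution.\<close>

definition free_adj ::
    "(('h::chilbert_space bop \<times> 'h bop) \<Rightarrow>\<^sub>0 complex) \<Rightarrow> ('h bop, 'h bop) tensor"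
  where "free_adj F = (\<Sum>k\<in>Poly_Mapping.keys F.
    cnj (Poly_Mapping.lookup F k) *\<^sub>C (adj (fst k) \<otimes> adj (snd k)))"

lemma free_adj_superset:
  assumes "finite S" "Poly_Mapping.keys F \<subseteq> S"
  shows "free_adj F = (\<Sum>k\<in>S. cnj (Poly_Mapping.lookup F k) *\<^sub>C (adj (fst k) \<otimes> adj (snd k)))"
  unfolding free_adj_def using assms
  by (intro sum.mono_neutral_left) (auto simp: in_keys_iff)

lemma free_adj_add: "free_adj (F + G) = free_adj F + free_adj G"
proof -
  let ?S = "Poly_Mapping.keys F \<union> Poly_Mapping.keys G"
  have "Poly_Mapping.keys (F + G) \<subseteq> ?S" by (rule Poly_Mapping.keys_add)
  then show ?thesis
    by (simp add: free_adj_superset[of ?S] lookup_add scaleC_add_left sum.distrib)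
qed

lemma free_adj_scaleC: "free_adj (c *\<^sub>C F) = cnj c *\<^sub>C free_adj F"
proof -
  have "Poly_Mapping.keys (c *\<^sub>C F) \<subseteq> Poly_Mapping.keys F"
    by (auto simp: in_keys_iff scaleC_poly_mapping.rep_eq)
  then show ?thesis
    by (simp add: free_adj_superset[of "Poly_Mapping.keys F"] scaleC_poly_mapping.rep_eq
        scaleC_sum_right scaleC_scaleC scaleC_complex_def)
qed

lemma free_adj_diff: "free_adj (F - G) = free_adj F - free_adj G"
  using free_adj_add[of "F - G" G] by simp

lemma free_adj_pure: "free_adj (pure_pair a b) = adj a \<otimes> adj b"
  by (simp add: free_adj_def scaleC_one)

text \<open>Applied to the difference of two representatives, this makes the involution of a tensor
  well defined.\<close>

lemma free_adj_null: "F \<in> tensor_null \<Longrightarrow> free_adj F = 0"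
proof (induction rule: tensor_null.induct)
  case null_zero
  then show ?case by (simp add: free_adj_def)
qed (simp_all add: free_adj_add free_adj_diff free_adj_scaleC free_adj_pure adj_add adj_scaleC
    tens_linear)

lemma tensor_adj_abs: "tensor_adj (abs_tensor F) = free_adj F"
proof -
  have "tensor_rel (rep_tensor (abs_tensor F)) F"
    using Quotient3_tensor by (metis Quotient3_rep_abs Quotient3_rel_rep tensor_rel_def
        diff_self null_zero)
  then have "free_adj (rep_tensor (abs_tensor F)) = free_adj F"
    using free_adj_null[of "rep_tensor (abs_tensor F) - F"]
    by (simp add: tensor_rel_def free_adj_diff)
  then show ?thesis
    by (simp add: tensor_adj_def free_adj_def case_prod_beta)
qed

lemma tensor_adj_tens: "tensor_adj (a \<otimes> b) = adj a \<otimes> adj b"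
  by (simp add: tens.abs_eq tensor_adj_abs free_adj_pure)

lemma tensor_adj_add: "tensor_adj (y + z) = tensor_adj y + tensor_adj z"
proof (induction y rule: tensor.abs_induct)
  case (1 F)
  show ?case
    by (induction z rule: tensor.abs_induct)
      (simp add: plus_tensor.abs_eq tensor_adj_abs free_adj_add)
qed

lemma tensor_adj_scaleC: "tensor_adj (c *\<^sub>C z) = cnj c *\<^sub>C tensor_adj z"
  by (induction z rule: tensor.abs_induct)
    (simp add: scaleC_tensor.abs_eq tensor_adj_abs free_adj_scaleC)

lemma tensor_adj_sum: "tensor_adj (\<Sum>k\<in>I. f k) = (\<Sum>k\<in>I. tensor_adj (f k))"
proof -
  have "tensor_adj 0 = 0" using tensor_adj_scaleC[of 0 0] by simp
  then show ?thesis
    by (induction I rule: infinite_finite_induct) (simp_all add: tensor_adj_add)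
qed

section \<open>The forms defined by a state\<close>

lemma commutant_closed:
  "1 \<in> commutant S" "a \<in> commutant S \<Longrightarrow> b \<in> commutant S \<Longrightarrow> a + b \<in> commutant S"
  "a \<in> commutant S \<Longrightarrow> b \<in> commutant S \<Longrightarrow> a * b \<in> commutant S"
  "a \<in> commutant S \<Longrightarrow> c *\<^sub>C a \<in> commutant S"
  "0 \<in> commutant S"
proof -
  show "a * b \<in> commutant S" if "a \<in> commutant S" "b \<in> commutant S"
  proof -
    have "d * (a * b) = (a * b) * d" if "d \<in> S" for d
    proof -
      have "d * a = a * d" "d * b = b * d"
        using \<open>a \<in> commutant S\<close> \<open>b \<in> commutant S\<close> that by (simp_all add: commutant_def)
      then show ?thesis by (metis mult.assoc)
    qed
    then show ?thesis by (simp add: commutant_def)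
  qed
qed (simp_all add: commutant_def distrib_left distrib_right bop_scaleC_mult)

locale von_neumann_state =
  fixes M :: "'h::chilbert_space bop set" and \<phi> :: "'h bop \<Rightarrow> complex"
  assumes vn: "von_neumann_algebra M" and state: "state_on M \<phi>"
begin

lemma M_adj: "a \<in> M \<Longrightarrow> adj a \<in> M"
  using vn by (simp add: von_neumann_algebra_def)

lemma M_commutant: "M = commutant (commutant M)"
  using vn by (simp add: von_neumann_algebra_def)

lemma M_zero: "0 \<in> M" and M_one: "1 \<in> M"
  and M_add: "a \<in> M \<Longrightarrow> b \<in> M \<Longrightarrow> a + b \<in> M"
  and M_mult: "a \<in> M \<Longrightarrow> b \<in> M \<Longrightarrow> a * b \<in> M"
  and M_scaleC: "a \<in> M \<Longrightarrow> c *\<^sub>C a \<in> M"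
  using commutant_closed[where S = "commutant M"] unfolding M_commutant[symmetric] by blast+

lemmas M_closed = M_zero M_one M_add M_mult M_scaleC M_adj

lemma phi_add: "a \<in> M \<Longrightarrow> b \<in> M \<Longrightarrow> \<phi> (a + b) = \<phi> a + \<phi> b"
  and phi_scaleC: "a \<in> M \<Longrightarrow> \<phi> (c *\<^sub>C a) = c * \<phi> a"
  and phi_positive: "a \<in> M \<Longrightarrow> positive_bop a \<Longrightarrow> \<phi> a \<in> \<real>\<^sub>\<ge>\<^sub>0"
  and phi_one: "\<phi> 1 = 1"
  using state by (simp_all add: state_on_def)

text \<open>The weights allow one to compare the Gram matrices of two families, such as \<open>(a\<^sub>k x)\<close> and
  \<open>(a\<^sub>k)\<close>: their difference is again a Gram matrix, with weight \<open>K - x x\<^sup>*\<close>.\<close>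

lemma weighted_left_form:
  assumes p: "p \<in> M" "positive_bop p"
  shows "psd_form M (\<lambda>a b. \<phi> (a * p * adj b))"
  by standard (simp_all add: M_closed p phi_add[symmetric] phi_scaleC[symmetric] adj_add adj_scaleC
      distrib_left distrib_right bop_scaleC_mult phi_positive positive_sandwich)

lemma weighted_right_form:
  assumes q: "q \<in> M" "positive_bop q"
  shows "psd_form M (\<lambda>a b. \<phi> (adj b * q * a))"
proof
  show "\<phi> (adj x * q * x) \<in> \<real>\<^sub>\<ge>\<^sub>0" if "x \<in> M" for x
    using positive_sandwich[OF q(2), of "adj x"] that
    by (simp add: M_closed q phi_positive)
qed (simp_all add: M_closed q phi_add[symmetric] phi_scaleC[symmetric] adj_add adj_scaleC
      distrib_left distrib_right bop_scaleC_mult)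

sublocale alg: psd_form M "alg_ip \<phi>"
  using weighted_left_form[OF M_one positive_one] by (simp add: alg_ip_def[abs_def])

lemma phi_adj: "a \<in> M \<Longrightarrow> \<phi> (adj a) = cnj (\<phi> a)"
  using alg.hermitian[of a 1] by (simp add: alg_ip_def M_closed)

text \<open>On tensors over \<open>M\<close> the functional \<open>\<phi> \<otimes> \<phi>\<^sup>o\<^sup>p\<close> is the restriction of a functional
  defined on all tensors, induced by a linear extension of \<open>\<phi>\<close>. This gives both
  well-definedness and linearity.\<close>

lemma tensor_state_extension:
  obtains T where "\<And>y z. T (y + z) = T y + T z" "\<And>c z. T (c *\<^sub>C z) = c * T z"
    "\<And>a b. a \<in> M \<Longrightarrow> b \<in> M \<Longrightarrow> T (a \<otimes> b) = \<phi> a * \<phi> b"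
    "\<And>z. z \<in> tensor_span M M \<Longrightarrow> tensor_state M \<phi> z = T z"
proof -
  obtain \<psi> where \<psi>: "\<And>x y. \<psi> (x + y) = \<psi> x + \<psi> y" "\<And>c x. \<psi> (c *\<^sub>C x) = c * \<psi> x"
    "\<And>x. x \<in> M \<Longrightarrow> \<psi> x = \<phi> x"
    by (rule linear_functional_extension[of M \<phi>]) (auto simp: M_closed phi_add phi_scaleC)
  define T where "T = tensor_lift (\<lambda>a b. \<psi> a * \<psi> b)"
  have bil: "cbilinear (\<lambda>a b. \<psi> a * \<psi> b)"
    by (simp add: cbilinear_def \<psi> scaleC_complex_def algebra_simps)
  have "tensor_state M \<phi> z = T z" if z: "z \<in> tensor_span M M" for z
  proof -
    have eq: "free_lift (\<lambda>(a, b). \<phi> a * \<phi> b) F = T (abs_tensor F)"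
      if "Poly_Mapping.keys F \<subseteq> M \<times> M" for F
      unfolding T_def tensor_lift_abs[OF bil] free_lift_def
      using that by (intro sum.cong refl) (auto simp: \<psi>(3))
    obtain F where F: "Poly_Mapping.keys F \<subseteq> M \<times> M" "z = abs_tensor F"
      using z by (auto simp: tensor_span_def)
    show ?thesis
      unfolding tensor_state_def
    proof (rule the_equality)
      show "\<exists>F. Poly_Mapping.keys F \<subseteq> M \<times> M \<and> abs_tensor F = z \<and>
          T z = free_lift (\<lambda>(a, b). \<phi> a * \<phi> b) F"
        using F eq[OF F(1)] by auto
    qed (use eq in auto)
  qed
  moreover have "T (c *\<^sub>C z) = c * T z" for c z
    by (simp add: T_def tensor_lift_scaleC bil scaleC_complex_def)
  moreover have "T (a \<otimes> b) = \<phi> a * \<phi> b" if "a \<in> M" "b \<in> M" for a b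
    using that by (simp add: T_def tensor_lift_tens bil \<psi>(3))
  ultimately show ?thesis
    using that[of T] by (simp add: T_def tensor_lift_add bil)
qed

lemma tensor_span_op_mult:
  assumes "y \<in> tensor_span M M" "z \<in> tensor_span M M"
  shows "op_mult y z \<in> tensor_span M M"
proof -
  obtain I :: "('h bop \<times> 'h bop) set" and a b where y: "finite I" "\<And>k. k \<in> I \<Longrightarrow> a k \<in> M"
    "\<And>k. k \<in> I \<Longrightarrow> b k \<in> M" "y = (\<Sum>k\<in>I. a k \<otimes> b k)"
    by (rule tensor_spanE[OF assms(1)], erule M_scaleC, rule that)
  obtain J :: "('h bop \<times> 'h bop) set" and c d where z: "finite J" "\<And>k. k \<in> J \<Longrightarrow> c k \<in> M"
    "\<And>k. k \<in> J \<Longrightarrow> d k \<in> M" "z = (\<Sum>k\<in>J. c k \<otimes> d k)"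
    by (rule tensor_spanE[OF assms(2)], erule M_scaleC, rule that)
  show ?thesis
    unfolding y(4) z(4) op_mult_sum op_mult_tens
    by (intro tensor_span_sum tensor_span_tens M_mult y z)
qed

lemma tensor_span_adj:
  assumes "z \<in> tensor_span M M"
  shows "tensor_adj z \<in> tensor_span M M"
proof -
  obtain J :: "('h bop \<times> 'h bop) set" and c d where z: "finite J" "\<And>k. k \<in> J \<Longrightarrow> c k \<in> M"
    "\<And>k. k \<in> J \<Longrightarrow> d k \<in> M" "z = (\<Sum>k\<in>J. c k \<otimes> d k)"
    by (rule tensor_spanE[OF assms], erule M_scaleC, rule that)
  show ?thesis
    unfolding z(4) tensor_adj_sum tensor_adj_tens
    by (intro tensor_span_sum tensor_span_tens M_adj z)
qed

text \<open>This formula exhibits the form as an entrywise product of Gram matrices, with the legs of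
  the second one in reversed order because of the opposite multiplication.\<close>

lemma tensor_ip_sum:
  assumes "\<And>k. k \<in> I \<Longrightarrow> a k \<in> M" "\<And>k. k \<in> I \<Longrightarrow> b k \<in> M"
    and "\<And>l. l \<in> J \<Longrightarrow> c l \<in> M" "\<And>l. l \<in> J \<Longrightarrow> d l \<in> M"
  shows "tensor_ip M \<phi> (\<Sum>k\<in>I. a k \<otimes> b k) (\<Sum>l\<in>J. c l \<otimes> d l)
    = (\<Sum>k\<in>I. \<Sum>l\<in>J. \<phi> (a k * adj (c l)) * \<phi> (adj (d l) * b k))"
proof -
  obtain T where T: "\<And>y z. T (y + z) = T y + T z" "\<And>c z. T (c *\<^sub>C z) = c * T z"
    "\<And>a b. a \<in> M \<Longrightarrow> b \<in> M \<Longrightarrow> T (a \<otimes> b) = \<phi> a * \<phi> b"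
    "\<And>z. z \<in> tensor_span M M \<Longrightarrow> tensor_state M \<phi> z = T z"
    by (rule tensor_state_extension; rule that; assumption)
  have T_zero: "T 0 = 0" using T(2)[of 0 0] by simp
  have T_sum: "T (\<Sum>k\<in>A. f k) = (\<Sum>k\<in>A. T (f k))" for A :: "'z set" and f
    by (induction A rule: infinite_finite_induct) (simp_all add: T_zero T(1))
  have "op_mult (\<Sum>k\<in>I. a k \<otimes> b k) (tensor_adj (\<Sum>l\<in>J. c l \<otimes> d l))
      = (\<Sum>k\<in>I. \<Sum>l\<in>J. (a k * adj (c l)) \<otimes> (adj (d l) * b k))"
    unfolding tensor_adj_sum tensor_adj_tens op_mult_sum op_mult_tens by (rule refl sum.swap)+
  moreover have "(\<Sum>k\<in>I. \<Sum>l\<in>J. (a k * adj (c l)) \<otimes> (adj (d l) * b k)) \<in> tensor_span M M"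
    by (intro tensor_span_sum tensor_span_tens M_mult M_adj assms)
  ultimately show ?thesis
    unfolding tensor_ip_def by (simp add: T(3,4) T_sum M_closed assms)
qed

sublocale ten: psd_form "tensor_span M M" "tensor_ip M \<phi>"
proof -
  obtain T where T: "\<And>y z. T (y + z) = T y + T z" "\<And>c z. T (c *\<^sub>C z) = c * T z"
    "\<And>a b. a \<in> M \<Longrightarrow> b \<in> M \<Longrightarrow> T (a \<otimes> b) = \<phi> a * \<phi> b"
    "\<And>z. z \<in> tensor_span M M \<Longrightarrow> tensor_state M \<phi> z = T z"
    by (rule tensor_state_extension; rule that; assumption)
  have ip: "tensor_ip M \<phi> y z = T (op_mult y (tensor_adj z))"
    if "y \<in> tensor_span M M" "z \<in> tensor_span M M" for y z
    using that by (simp add: tensor_ip_def T(4) tensor_span_op_mult tensor_span_adj)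
  show "psd_form (tensor_span M M) (tensor_ip M \<phi>)"
  proof
    fix z assume z: "z \<in> tensor_span M M"
    obtain I :: "('h bop \<times> 'h bop) set" and a b where ab: "finite I" "\<And>k. k \<in> I \<Longrightarrow> a k \<in> M"
      "\<And>k. k \<in> I \<Longrightarrow> b k \<in> M" "z = (\<Sum>k\<in>I. a k \<otimes> b k)"
      by (rule tensor_spanE[OF z], erule M_scaleC, rule that)
    show "tensor_ip M \<phi> z z \<in> \<real>\<^sub>\<ge>\<^sub>0"
      using schur_product_nonneg[OF weighted_left_form[OF M_one positive_one]
          weighted_right_form[OF M_one positive_one] ab(1), of a b] ab(2,3)
      by (simp add: ab(4) tensor_ip_sum)
  qed (simp_all add: ip tensor_span_zero tensor_span_add tensor_span_scaleC T(1,2) op_mult_linear_left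
      op_mult_linear_right tensor_adj_add tensor_adj_scaleC)
qed

lemma tensor_ip_tens:
  assumes "a \<in> M" "b \<in> M" "c \<in> M" "d \<in> M"
  shows "tensor_ip M \<phi> (a \<otimes> b) (c \<otimes> d) = \<phi> (a * adj c) * \<phi> (adj d * b)"
  using tensor_ip_sum[of "{0::nat}" "\<lambda>_. a" "\<lambda>_. b" "{0::nat}" "\<lambda>_. c" "\<lambda>_. d"] assms by simp

text \<open>In \<open>(\<phi> \<otimes> \<phi>\<^sup>o\<^sup>p)(z z\<^sup>*)\<close> a right factor of \<open>z\<close> meets its own adjoint in the middle of
  the product, which is why right multiplication is bounded. The difference of the two sides is
  the Schur product of the Gram matrices with weights \<open>K - x x\<^sup>*\<close> and \<open>1\<close>.\<close>

lemma norm_op_mult_first_leg: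
  assumes x: "x \<in> M" and K: "positive_bop (complex_of_real K *\<^sub>C 1 - x * adj x)"
    and z: "z \<in> tensor_span M M"
  shows "(ten.N (op_mult z (x \<otimes> 1)))\<^sup>2 \<le> K * (ten.N z)\<^sup>2"
proof -
  obtain I :: "('h bop \<times> 'h bop) set" and a b where ab: "finite I" "\<And>k. k \<in> I \<Longrightarrow> a k \<in> M"
    "\<And>k. k \<in> I \<Longrightarrow> b k \<in> M" "z = (\<Sum>k\<in>I. a k \<otimes> b k)"
    by (rule tensor_spanE[OF z], erule M_scaleC, rule that)
  define p where "p = complex_of_real K *\<^sub>C 1 - x * adj x"
  have p: "p \<in> M" unfolding p_def by (intro alg.diff_mem M_closed x)
  have zx: "op_mult z (x \<otimes> 1) = (\<Sum>k\<in>I. (a k * x) \<otimes> b k)"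
    by (simp add: ab(4) op_mult_sum op_mult_tens)
  have "\<phi> (a k * p * adj (a l)) = K * \<phi> (a k * adj (a l)) - \<phi> (a k * x * adj (a l * x))"
    if "k \<in> I" "l \<in> I" for k l
  proof -
    have eq: "a k * p * adj (a l) + a k * x * adj (a l * x) = complex_of_real K *\<^sub>C (a k * adj (a l))"
      by (simp add: p_def algebra_simps bop_scaleC_mult adj_mult)
    have mem: "a k * p * adj (a l) \<in> M" "a k * x * adj (a l * x) \<in> M" "a k * adj (a l) \<in> M"
      using that by (intro M_closed ab p x; simp)+
    show ?thesis
      using arg_cong[OF eq, of \<phi>] unfolding phi_add[OF mem(1,2)] phi_scaleC[OF mem(3)]
      by (simp add: eq_diff_eq)
  qed
  then have "(\<Sum>k\<in>I. \<Sum>l\<in>I. \<phi> (a k * p * adj (a l)) * \<phi> (adj (b l) * 1 * b k))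
      = K * tensor_ip M \<phi> z z - tensor_ip M \<phi> (op_mult z (x \<otimes> 1)) (op_mult z (x \<otimes> 1))"
    unfolding zx unfolding ab(4)
    by (simp add: tensor_ip_sum ab M_closed x sum_distrib_left sum_subtractf[symmetric]
        left_diff_distrib mult.assoc cong: sum.cong)
  moreover have "(\<Sum>k\<in>I. \<Sum>l\<in>I. \<phi> (a k * p * adj (a l)) * \<phi> (adj (b l) * 1 * b k)) \<in> \<real>\<^sub>\<ge>\<^sub>0"
    by (rule schur_product_nonneg[OF weighted_left_form weighted_right_form[OF M_one positive_one] ab(1)])
      (use p K ab in \<open>auto simp: p_def\<close>)
  moreover have "op_mult z (x \<otimes> 1) \<in> tensor_span M M"
    by (intro tensor_span_op_mult tensor_span_tens z x M_one)
  ultimately show ?thesis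
    using z by (simp add: ten.N_sq complex_nonneg_Reals_iff)
qed

text \<open>In the opposite algebra, multiplying the second leg by \<open>x\<close> on the right turns \<open>b\<close> into
  \<open>x b\<close>, so here the weight is \<open>K - x\<^sup>* x\<close>.\<close>

lemma norm_op_mult_second_leg:
  assumes x: "x \<in> M" and K: "positive_bop (complex_of_real K *\<^sub>C 1 - adj x * x)"
    and z: "z \<in> tensor_span M M"
  shows "(ten.N (op_mult z (1 \<otimes> x)))\<^sup>2 \<le> K * (ten.N z)\<^sup>2"
proof -
  obtain I :: "('h bop \<times> 'h bop) set" and a b where ab: "finite I" "\<And>k. k \<in> I \<Longrightarrow> a k \<in> M"
    "\<And>k. k \<in> I \<Longrightarrow> b k \<in> M" "z = (\<Sum>k\<in>I. a k \<otimes> b k)"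
    by (rule tensor_spanE[OF z], erule M_scaleC, rule that)
  define q where "q = complex_of_real K *\<^sub>C 1 - adj x * x"
  have q: "q \<in> M" unfolding q_def by (intro alg.diff_mem M_closed x)
  have zx: "op_mult z (1 \<otimes> x) = (\<Sum>k\<in>I. a k \<otimes> (x * b k))"
    by (simp add: ab(4) op_mult_sum op_mult_tens)
  have "\<phi> (adj (b l) * q * b k) = K * \<phi> (adj (b l) * b k) - \<phi> (adj (x * b l) * (x * b k))"
    if "k \<in> I" "l \<in> I" for k l
  proof -
    have eq: "adj (b l) * q * b k + adj (x * b l) * (x * b k) = complex_of_real K *\<^sub>C (adj (b l) * b k)"
      by (simp add: q_def algebra_simps bop_scaleC_mult adj_mult)
    have mem: "adj (b l) * q * b k \<in> M" "adj (x * b l) * (x * b k) \<in> M" "adj (b l) * b k \<in> M"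
      using that by (intro M_closed ab q x; simp)+
    show ?thesis
      using arg_cong[OF eq, of \<phi>] unfolding phi_add[OF mem(1,2)] phi_scaleC[OF mem(3)]
      by (simp add: eq_diff_eq)
  qed
  then have "(\<Sum>k\<in>I. \<Sum>l\<in>I. \<phi> (a k * 1 * adj (a l)) * \<phi> (adj (b l) * q * b k))
      = K * tensor_ip M \<phi> z z - tensor_ip M \<phi> (op_mult z (1 \<otimes> x)) (op_mult z (1 \<otimes> x))"
    unfolding zx unfolding ab(4)
    by (simp add: tensor_ip_sum ab M_closed x sum_distrib_left sum_subtractf[symmetric]
        right_diff_distrib mult.left_commute cong: sum.cong)
  moreover have "(\<Sum>k\<in>I. \<Sum>l\<in>I. \<phi> (a k * 1 * adj (a l)) * \<phi> (adj (b l) * q * b k)) \<in> \<real>\<^sub>\<ge>\<^sub>0"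
    by (rule schur_product_nonneg[OF weighted_left_form[OF M_one positive_one] weighted_right_form ab(1)])
      (use q K ab in \<open>auto simp: q_def\<close>)
  moreover have "op_mult z (1 \<otimes> x) \<in> tensor_span M M"
    by (intro tensor_span_op_mult tensor_span_tens z x M_one)
  ultimately show ?thesis
    using z by (simp add: ten.N_sq complex_nonneg_Reals_iff)
qed

text \<open>The right-hand side is \<open>\<phi>(a a\<^sup>*) + \<phi>(a\<^sup>* a) - 2 \<bar>\<phi>(a)\<bar>\<^sup>2\<close>, the sum of the variances of
  \<open>a\<close> and of \<open>a\<^sup>*\<close>; for a trace it is twice the left-hand side.\<close>

lemma norm_commutator_tensor:
  assumes a: "a \<in> M"
  shows "(alg.N (a - \<phi> a *\<^sub>C 1))\<^sup>2 \<le> (ten.N (a \<otimes> 1 - 1 \<otimes> a))\<^sup>2"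
proof -
  have mem: "a \<otimes> 1 \<in> tensor_span M M" "1 \<otimes> a \<in> tensor_span M M"
    by (intro tensor_span_tens a M_one)+
  have sq: "\<phi> a * cnj (\<phi> a) = complex_of_real ((cmod (\<phi> a))\<^sup>2)"
    by (simp add: complex_norm_square[symmetric])
  have "(alg.N (a - \<phi> a *\<^sub>C 1))\<^sup>2 = Re (\<phi> (a * adj a)) - (cmod (\<phi> a))\<^sup>2"
    by (simp add: alg.N_sq alg.diff_mem alg.diff_left alg.diff_right alg.scaleC_left alg.scaleC_right
        M_closed a) (simp add: alg_ip_def phi_one phi_adj a cmod_power2, simp add: power2_eq_square)
  moreover have "(ten.N (a \<otimes> 1 - 1 \<otimes> a))\<^sup>2
      = Re (\<phi> (a * adj a)) + Re (\<phi> (adj a * a)) - 2 * (cmod (\<phi> a))\<^sup>2"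
    using mem by (simp add: ten.N_sq_diff ten.N_sq tensor_ip_tens M_one a phi_one phi_adj sq)
  moreover have "(cmod (\<phi> a))\<^sup>2 \<le> Re (\<phi> (adj a * a))"
  proof -
    have "alg.N 1 = 1" by (simp add: ip_norm_def alg_ip_def phi_one)
    then have "cmod (alg_ip \<phi> (adj a) 1) \<le> alg.N (adj a)"
      using alg.cauchy_schwarz[of "adj a" 1] by (simp add: M_closed a)
    then have "(cmod (\<phi> a))\<^sup>2 \<le> (alg.N (adj a))\<^sup>2"
      by (intro power_mono) (simp_all add: alg_ip_def phi_adj a)
    then show ?thesis by (simp add: alg.N_sq M_closed a) (simp add: alg_ip_def)
  qed
  ultimately show ?thesis by simp
qed

end

section \<open>Evaluation of polynomials and derivatives\<close>

lemma nc_eval_add: "nc_eval X (P + Q) = nc_eval X P + nc_eval X Q"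
  and nc_eval_scaleC: "nc_eval X (c *\<^sub>C P) = c *\<^sub>C nc_eval X P"
  by (simp_all add: nc_eval_def free_lift_add free_lift_scaleC)

lemma nc_eval_monom: "nc_eval X (nc_monom w) = (\<Prod>i\<leftarrow>w. X $ i)"
  by (simp add: nc_eval_def nc_monom_def free_lift_single scaleC_one)

lemma nc_eval_var: "nc_eval X (nc_var i) = X $ i"
  by (simp add: nc_var_def nc_eval_monom)

lemma nc_monom_Nil: "nc_monom [] = 1"
  by (simp add: nc_monom_def zero_list_def[symmetric] single_one)

lemma nc_eval_one: "nc_eval X 1 = 1"
  using nc_eval_monom[of X "[]"] by (simp add: nc_monom_Nil)

lemma tensor_eval_cbilinear: "cbilinear (\<lambda>P Q. nc_eval X P \<otimes> nc_eval X Q)"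
  by (simp add: cbilinear_def nc_eval_add nc_eval_scaleC tens_linear)

lemma tensor_eval_tens: "tensor_eval X (P \<otimes> Q) = nc_eval X P \<otimes> nc_eval X Q"
  and tensor_eval_add: "tensor_eval X (y + z) = tensor_eval X y + tensor_eval X z"
  and tensor_eval_scaleC: "tensor_eval X (c *\<^sub>C z) = c *\<^sub>C tensor_eval X z"
  and tensor_eval_sum: "tensor_eval X (\<Sum>k\<in>I. f k) = (\<Sum>k\<in>I. tensor_eval X (f k))"
  by (simp_all add: tensor_eval_def tensor_lift_tens tensor_lift_add tensor_lift_scaleC
      tensor_lift_sum tensor_eval_cbilinear)

lemma op_mult_diff_right: "op_mult y (z - z') = op_mult y z - op_mult y z'"
  using op_mult_linear_right(1)[of y "z - z'" z'] by simp

text \<open>For a word \<open>w\<close>, the occurrence of a letter at position \<open>k\<close> contributes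
  \<open>u\<^sub>k\<^sub>+\<^sub>1 \<otimes> v\<^sub>k\<^sub>+\<^sub>1 - u\<^sub>k \<otimes> v\<^sub>k\<close>, where \<open>u\<^sub>k\<close> and \<open>v\<^sub>k\<close> are the values of the first \<open>k\<close>
  letters and of the remaining ones. The sum over all positions telescopes.\<close>

lemma sum_deriv_commutator:
  fixes X :: "'h::chilbert_space bop ^ 'n"
  shows "(\<Sum>i\<in>UNIV. op_mult (tensor_eval X (nc_deriv i P)) (X $ i \<otimes> 1 - 1 \<otimes> X $ i))
    = nc_eval X P \<otimes> 1 - 1 \<otimes> nc_eval X P"
proof (induction P rule: ncpoly_induct)
  case (single w c)
  let ?p = "\<lambda>w. \<Prod>i\<leftarrow>w. X $ i"
  let ?t = "\<lambda>k. ?p (take k w) \<otimes> ?p (drop k w)"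
  have summand: "op_mult (?p (take k w) \<otimes> ?p (drop (Suc k) w)) (X $ (w ! k) \<otimes> 1 - 1 \<otimes> X $ (w ! k))
      = ?t (Suc k) - ?t k" if "k < length w" for k
  proof -
    have "?p (take (Suc k) w) = ?p (take k w) * X $ (w ! k)"
      using that by (simp add: take_Suc_conv_app_nth)
    moreover have "?p (drop k w) = X $ (w ! k) * ?p (drop (Suc k) w)"
      using that by (simp add: Cons_nth_drop_Suc[symmetric])
    ultimately show ?thesis by (simp add: op_mult_diff_right op_mult_tens)
  qed
  have "(\<Sum>i\<in>UNIV. op_mult (tensor_eval X (word_deriv i w)) (X $ i \<otimes> 1 - 1 \<otimes> X $ i))
      = (\<Sum>i\<in>UNIV. \<Sum>k | k \<in> {..<length w} \<and> w ! k = i. ?t (Suc k) - ?t k)"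
    unfolding word_deriv_def tensor_eval_sum tensor_eval_tens nc_eval_monom op_mult_sum
    by (intro sum.cong refl) (auto simp: summand)
  also have "\<dots> = (\<Sum>k<length w. ?t (Suc k) - ?t k)"
    by (rule sum.group) auto
  also have "\<dots> = ?t (length w) - ?t 0"
    by (rule sum_lessThan_telescope)
  also have "\<dots> = nc_eval X (nc_monom w) \<otimes> 1 - 1 \<otimes> nc_eval X (nc_monom w)"
    by (simp add: nc_eval_monom)
  finally show ?case
    by (simp add: nc_deriv_scaleC nc_deriv_monom tensor_eval_scaleC op_mult_linear_left
        nc_eval_scaleC tens_linear scaleC_diff_right scaleC_sum_right[symmetric])
next
  case (add P Q)
  then show ?case
    by (simp add: nc_deriv_add tensor_eval_add op_mult_linear_left sum.distrib nc_eval_add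
        tens_linear)
qed

definition jacobian_eval ::
    "'h::chilbert_space bop ^ 'n \<Rightarrow> 'n ncpoly ^ 'n \<Rightarrow> ('h bop, 'h bop) tensor ^ 'n ^ 'n"
  where "jacobian_eval X P = mat_eval X (jacobian P)"

lemma jacobian_eval_component: "jacobian_eval X P $ i $ j = tensor_eval X (nc_deriv j (P $ i))"
  by (simp add: jacobian_eval_def mat_eval_def jacobian_def)

lemma jacobian_eval_add: "jacobian_eval X (P + Q) = jacobian_eval X P + jacobian_eval X Q"
  and jacobian_eval_scaleC: "jacobian_eval X (c *\<^sub>C P) = c *\<^sub>C jacobian_eval X P"
  by (simp_all add: vec_eq_iff jacobian_eval_component nc_deriv_add nc_deriv_scaleC
      tensor_eval_add tensor_eval_scaleC)

lemma jacobian_eval_diff: "jacobian_eval X (P - Q) = jacobian_eval X P - jacobian_eval X Q"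
  using jacobian_eval_add[of X "P - Q" Q] by simp

lemma jacobian_eval_vars:
  "jacobian_eval X (\<chi> i. nc_var i) = mat (1 \<otimes> 1)"
proof -
  have "tensor_eval X 0 = 0" using tensor_eval_scaleC[of X 0 0] by simp
  then show ?thesis
    by (simp add: vec_eq_iff jacobian_eval_component nc_deriv_var mat_def tensor_eval_tens nc_eval_one)
qed

lemma vec_eval_vars: "vec_eval X (\<chi> i. nc_var i) = X"
  by (simp add: vec_eval_def nc_eval_var vec_eq_iff)

context von_neumann_state begin

lemma ten_norm_one: "ten.N (1 \<otimes> 1) = 1"
  by (simp add: ip_norm_def tensor_ip_tens M_one phi_one)

sublocale vec: psd_form "{Y :: 'h bop ^ 'n. \<forall>i. Y $ i \<in> M}" "vec_ip \<phi>"
  using psd_form_vec[OF alg.psd_form_axioms] by (simp add: vec_ip_def[abs_def])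

sublocale mat: psd_form "tensor_mats M :: (('h bop, 'h bop) tensor ^ 'n ^ 'n) set" "mat_ip M \<phi>"
proof -
  have "tensor_mats M = {A :: ('h bop, 'h bop) tensor ^ 'n ^ 'n. \<forall>i. A $ i \<in> {x. \<forall>j. x $ j \<in> tensor_span M M}}"
    by (simp add: tensor_mats_def)
  moreover have "mat_ip M \<phi> = (\<lambda>A B :: ('h bop, 'h bop) tensor ^ 'n ^ 'n.
      \<Sum>i\<in>UNIV. \<Sum>j\<in>UNIV. tensor_ip M \<phi> (A $ i $ j) (B $ i $ j))"
    by (intro ext) (simp add: mat_ip_def)
  ultimately show "psd_form (tensor_mats M) (mat_ip M \<phi> :: ('h bop, 'h bop) tensor ^ 'n ^ 'n \<Rightarrow> _)"
    using psd_form_vec[OF psd_form_vec[OF ten.psd_form_axioms]] by simp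
qed

lemma vec_norm_sq:
  "(\<And>i. Y $ i \<in> M) \<Longrightarrow> (vec.N Y)\<^sup>2 = (\<Sum>i\<in>UNIV. (alg.N (Y $ i))\<^sup>2)"
  by (simp add: vec.N_sq alg.N_sq) (simp add: vec_ip_def)

lemma mat_norm_sq:
  assumes "A \<in> tensor_mats M"
  shows "(mat.N A)\<^sup>2 = (\<Sum>i\<in>UNIV. \<Sum>j\<in>UNIV. (ten.N (A $ i $ j))\<^sup>2)"
  using assms unfolding mat.N_sq[OF assms]
  by (simp add: ten.N_sq tensor_mats_def) (simp add: mat_ip_def)

context
  fixes X :: "'h bop ^ 'n"
  assumes X_mem: "\<And>i. X $ i \<in> M" and X_adj: "\<And>i. adj (X $ i) = X $ i"
begin

lemma nc_eval_mem: "nc_eval X P \<in> M"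
proof (induction P rule: ncpoly_induct)
  case (single w c)
  have "(\<Prod>i\<leftarrow>w. X $ i) \<in> M"
    by (induction w) (simp_all add: M_closed X_mem)
  then show ?case by (simp add: nc_eval_scaleC nc_eval_monom M_scaleC)
qed (simp add: nc_eval_add M_add)

lemma vec_eval_mem: "vec_eval X P $ i \<in> M"
  by (simp add: vec_eval_def nc_eval_mem)

lemma tensor_eval_mem: "tensor_eval X z \<in> tensor_span M M"
proof -
  obtain I :: "('n ncpoly \<times> 'n ncpoly) set" and P Q where "z = (\<Sum>k\<in>I. P k \<otimes> Q k)"
  proof (rule tensor_spanE[of z UNIV UNIV])
    show "z \<in> tensor_span UNIV UNIV"
      by (induction z rule: tensor.abs_induct) (auto simp: tensor_span_def)
  qed (use that in simp_all)
  then show ?thesis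
    by (simp add: tensor_eval_sum tensor_eval_tens tensor_span_sum tensor_span_tens nc_eval_mem)
qed

lemma jacobian_eval_mem: "jacobian_eval X P \<in> tensor_mats M"
  by (simp add: tensor_mats_def jacobian_eval_component tensor_eval_mem)

section \<open>The free Poincare inequality\<close>

text \<open>The norm of \<open>P(X) \<otimes> 1 - 1 \<otimes> P(X) = \<Sum>\<^sub>i \<partial>\<^sub>iP \<sharp> (x\<^sub>i \<otimes> 1 - 1 \<otimes> x\<^sub>i)\<close> dominates the
  left-hand side of the inequality and is at most \<open>\<Sum>\<^sub>i 2 \<surd>K\<^sub>i \<parallel>\<partial>\<^sub>iP\<parallel>\<close> if
  \<open>x\<^sub>i\<^sup>2 \<le> K\<^sub>i\<close>. The Cauchy-Schwarz inequality for sums turns this into the constant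
  \<open>4 \<Sum>\<^sub>i K\<^sub>i\<close>.\<close>

lemma free_poincare_exists: "\<exists>c. free_poincare M \<phi> X c"
proof -
  have "\<exists>K\<ge>0. positive_bop (complex_of_real K *\<^sub>C 1 - X $ i * X $ i)" for i
    using positive_dominating_scalar[of "X $ i"] X_adj by metis
  then obtain K where K: "\<And>i. K i \<ge> 0"
    "\<And>i. positive_bop (complex_of_real (K i) *\<^sub>C 1 - X $ i * X $ i)" by metis
  have "(alg.N (nc_eval X P - \<phi> (nc_eval X P) *\<^sub>C 1))\<^sup>2
      \<le> (\<Sum>i\<in>UNIV. 4 * K i) * (\<Sum>i\<in>UNIV. (ten.N (tensor_eval X (nc_deriv i P)))\<^sup>2)" for P
  proof -
    define z where "z i = tensor_eval X (nc_deriv i P)" for i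
    have z: "z i \<in> tensor_span M M" for i by (simp add: z_def tensor_eval_mem)
    define w where "w i = op_mult (z i) (X $ i \<otimes> 1 - 1 \<otimes> X $ i)" for i
    have mem: "op_mult (z i) (X $ i \<otimes> 1) \<in> tensor_span M M"
      "op_mult (z i) (1 \<otimes> X $ i) \<in> tensor_span M M" for i
      by (intro tensor_span_op_mult tensor_span_tens z X_mem M_one)+
    have w_mem: "w i \<in> tensor_span M M" for i
      unfolding w_def op_mult_diff_right by (intro ten.diff_mem mem)
    have w_le: "ten.N (w i) \<le> (2 * sqrt (K i)) * ten.N (z i)" for i
    proof -
      have sq: "(sqrt (K i) * ten.N (z i))\<^sup>2 = K i * (ten.N (z i))\<^sup>2"
        using K(1)[of i] by (simp add: power_mult_distrib)
      have nonneg: "0 \<le> sqrt (K i) * ten.N (z i)"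
        using K(1)[of i] ten.N_nonneg[OF z] by simp
      have le1: "ten.N (op_mult (z i) (X $ i \<otimes> 1)) \<le> sqrt (K i) * ten.N (z i)"
        by (rule power2_le_imp_le[OF _ nonneg], unfold sq, rule norm_op_mult_first_leg)
          (simp_all only: X_mem X_adj K z)
      have le2: "ten.N (op_mult (z i) (1 \<otimes> X $ i)) \<le> sqrt (K i) * ten.N (z i)"
        by (rule power2_le_imp_le[OF _ nonneg], unfold sq, rule norm_op_mult_second_leg)
          (simp_all only: X_mem X_adj K z)
      have "ten.N (w i) \<le> ten.N (op_mult (z i) (X $ i \<otimes> 1)) + ten.N (- op_mult (z i) (1 \<otimes> X $ i))"
        using ten.triangle[OF mem(1) ten.uminus_mem[OF mem(2)], of i i]
        by (simp add: w_def op_mult_diff_right)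
      also have "ten.N (- op_mult (z i) (1 \<otimes> X $ i)) = ten.N (op_mult (z i) (1 \<otimes> X $ i))"
        unfolding ten.uminus_scaleC[of "op_mult (z i) (1 \<otimes> X $ i)"] ten.N_scaleC[OF mem(2)] by simp
      finally show ?thesis using le1 le2 by linarith
    qed
    have "(alg.N (nc_eval X P - \<phi> (nc_eval X P) *\<^sub>C 1))\<^sup>2
        \<le> (ten.N (nc_eval X P \<otimes> 1 - 1 \<otimes> nc_eval X P))\<^sup>2"
      by (rule norm_commutator_tensor[OF nc_eval_mem])
    also have "nc_eval X P \<otimes> 1 - 1 \<otimes> nc_eval X P = (\<Sum>i\<in>UNIV. w i)"
      by (simp add: w_def z_def sum_deriv_commutator)
    also have "(ten.N (\<Sum>i\<in>UNIV. w i))\<^sup>2 \<le> (\<Sum>i\<in>UNIV. (2 * sqrt (K i)) * ten.N (z i))\<^sup>2"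
    proof (rule power_mono)
      show "ten.N (\<Sum>i\<in>UNIV. w i) \<le> (\<Sum>i\<in>UNIV. (2 * sqrt (K i)) * ten.N (z i))"
        by (rule order_trans[OF ten.N_sum sum_mono]) (rule w_mem w_le)+
    qed (simp add: ten.N_nonneg ten.sum_mem w_mem)
    also have "\<dots> \<le> (\<Sum>i\<in>UNIV. (2 * sqrt (K i))\<^sup>2) * (\<Sum>i\<in>UNIV. (ten.N (z i))\<^sup>2)"
      by (rule Cauchy_Schwarz_ineq_sum)
    also have "(\<Sum>i\<in>UNIV. (2 * sqrt (K i))\<^sup>2) = (\<Sum>i\<in>UNIV. 4 * K i)"
      using K(1) by (simp add: power_mult_distrib)
    finally show ?thesis by (simp add: z_def)
  qed
  then show ?thesis unfolding free_poincare_def by blast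
qed

text \<open>Tested on a variable, whose derivatives have total squared norm \<open>1\<close>.\<close>

lemma free_poincare_nonneg:
  assumes "free_poincare M \<phi> X c"
  shows "0 \<le> c"
proof -
  define i :: 'n where "i = undefined"
  have "tensor_eval X (nc_deriv j (nc_var i)) = (if j = i then 1 \<otimes> 1 else 0)" for j
    using tensor_eval_scaleC[of X 0 0] by (simp add: nc_deriv_var tensor_eval_tens nc_eval_one)
  then have "(\<Sum>j\<in>UNIV. (ten.N (tensor_eval X (nc_deriv j (nc_var i))))\<^sup>2) = 1"
    by (simp add: if_distrib[of "\<lambda>x. (ten.N x)\<^sup>2"] ten_norm_one ten.N_zero cong: if_cong)
  then show ?thesis
    using spec[OF assms[unfolded free_poincare_def], of "nc_var i"]
      order_trans[OF zero_le_power2] by fastforce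
qed

lemma C_opt_nonneg: "0 \<le> C_opt M \<phi> X"
  unfolding C_opt_def using free_poincare_exists free_poincare_nonneg
  by (intro cInf_greatest) auto

text \<open>For fixed \<open>P\<close> the inequality is a closed condition on the constant, so it passes to the
  infimum.\<close>

lemma free_poincare_C_opt: "free_poincare M \<phi> X (C_opt M \<phi> X)"
  unfolding free_poincare_def
proof
  fix P
  let ?l = "(alg.N (nc_eval X P - \<phi> (nc_eval X P) *\<^sub>C 1))\<^sup>2"
  let ?s = "\<Sum>i\<in>UNIV. (ten.N (tensor_eval X (nc_deriv i P)))\<^sup>2"
  have le: "?l \<le> c * ?s" if "free_poincare M \<phi> X c" for c
    using that by (simp add: free_poincare_def)
  have "?s \<ge> 0" by (intro sum_nonneg) simp
  show "?l \<le> C_opt M \<phi> X * ?s"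
  proof (cases "?s = 0")
    case True
    obtain c where "free_poincare M \<phi> X c" using free_poincare_exists by blast
    from le[OF this] True show ?thesis by simp
  next
    case False
    then have pos: "?s > 0" using \<open>?s \<ge> 0\<close> by linarith
    have "?l / ?s \<le> C_opt M \<phi> X"
      unfolding C_opt_def
    proof (rule cInf_greatest)
      show "{c. free_poincare M \<phi> X c} \<noteq> {}" using free_poincare_exists by blast
      show "?l / ?s \<le> c" if "c \<in> {c. free_poincare M \<phi> X c}" for c
        using le[of c] that pos by (simp only: mem_Collect_eq divide_le_eq if_True)
    qed
    then show ?thesis using pos by (simp add: divide_le_eq)
  qed
qed

end

end

section \<open>Existence of free Stein kernels\<close>

context von_neumann_state begin

lemma mat_one_mem: "mat (1 \<otimes> 1) \<in> tensor_mats M"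
  by (simp add: tensor_mats_def mat_def tensor_span_tens M_one tensor_span_zero)

lemma mat_norm_one: "(mat.N (mat (1 \<otimes> 1) :: ('h bop, 'h bop) tensor ^ 'n ^ 'n))\<^sup>2 = real CARD('n)"
proof -
  have "(ten.N ((mat (1 \<otimes> 1) :: ('h bop, 'h bop) tensor ^ 'n ^ 'n) $ i $ j))\<^sup>2
      = (if i = j then 1 else 0)" for i j
    by (simp add: mat_def ten_norm_one ten.N_zero)
  then show ?thesis
    by (simp add: mat_norm_sq[OF mat_one_mem])
qed

lemma L2_mats_cases:
  assumes "A \<in> L2_mats M \<phi>"
  obtains S where "S \<in> cauchy_seqs (tensor_mats M) (mat_ip M \<phi>)" "A = mat.cls S"
  using assms unfolding L2_mats_def completion_def by (rule quotientE)

lemma stein_dist_limit: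
  assumes S: "S \<in> cauchy_seqs (tensor_mats M) (mat_ip M \<phi>)"
    and lim: "(\<lambda>k. (mat.N (S k - mat (1 \<otimes> 1)))\<^sup>2) \<longlonglongrightarrow> l"
  shows "(stein_dist M \<phi> (mat.cls S))\<^sup>2 = l" "0 \<le> stein_dist M \<phi> (mat.cls S)"
proof -
  define D where "D = (\<lambda>k. S k - mat (1 \<otimes> 1))"
  have I: "(\<lambda>_. mat (1 \<otimes> 1)) \<in> cauchy_seqs (tensor_mats M) (mat_ip M \<phi>)"
    by (rule mat.cauchy_const[OF mat_one_mem])
  have D: "D \<in> cauchy_seqs (tensor_mats M) (mat_ip M \<phi>)"
    unfolding D_def by (rule mat.cauchy_diff[OF S I])
  have "mat_ip M \<phi> (D k) (D k) = complex_of_real ((mat.N (D k))\<^sup>2)" for k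
    by (rule mat.self_eq[OF mat.cauchy_mem[OF D]])
  then have "(\<lambda>k. mat_ip M \<phi> (D k) (D k)) \<longlonglongrightarrow> complex_of_real l"
    using tendsto_of_real[OF lim, where 'a = complex] by (simp add: D_def)
  then have "L2_ip M \<phi> (mat.cls D) (mat.cls D) = complex_of_real l"
    unfolding L2_ip_def by (rule mat.compl_ip_cls[OF D D])
  then have "stein_dist M \<phi> (mat.cls S) = sqrt l"
    by (simp add: stein_dist_def L2_embed_def compl_embed_def mat.compl_diff_cls[OF S I] D_def[symmetric]
        ip_norm_def)
  moreover have "0 \<le> l" using lim by (rule LIMSEQ_le_const) auto
  ultimately show "(stein_dist M \<phi> (mat.cls S))\<^sup>2 = l" "0 \<le> stein_dist M \<phi> (mat.cls S)"
    by simp_all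
qed

text \<open>Nonnegativity bounds the infimum in the free Stein discrepancy from below; it needs a
  proof because the square root of a negative number is negative here.\<close>

lemma stein_dist_nonneg:
  assumes "A \<in> L2_mats M \<phi>"
  shows "0 \<le> stein_dist M \<phi> A"
proof -
  obtain S where S: "S \<in> cauchy_seqs (tensor_mats M) (mat_ip M \<phi>)" "A = mat.cls S"
    using L2_mats_cases[OF assms] .
  define D where "D = (\<lambda>k. S k - mat (1 \<otimes> 1))"
  have D: "D \<in> cauchy_seqs (tensor_mats M) (mat_ip M \<phi>)"
    unfolding D_def by (rule mat.cauchy_diff[OF S(1) mat.cauchy_const[OF mat_one_mem]])
  obtain w where w: "(\<lambda>k. mat_ip M \<phi> (D k) (D k)) \<longlonglongrightarrow> w"
    using mat.ip_convergent[OF D D] unfolding convergent_def by (rule exE)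
  have "(\<lambda>k. (mat.N (D k))\<^sup>2) \<longlonglongrightarrow> Re w"
    using tendsto_Re[OF w] by (simp only: mat.N_sq[OF mat.cauchy_mem[OF D]])
  then show ?thesis
    using stein_dist_limit(2)[OF S(1)] by (simp add: S(2) D_def)
qed

lemma free_stein_discrepancy_le:
  assumes "free_stein_kernel M \<phi> X V A"
  shows "(free_stein_discrepancy M \<phi> X V)\<^sup>2 \<le> (stein_dist M \<phi> A)\<^sup>2"
proof -
  let ?S = "stein_dist M \<phi> ` {A. free_stein_kernel M \<phi> X V A}"
  have lower: "0 \<le> d" if "d \<in> ?S" for d
    using that stein_dist_nonneg by (auto simp: free_stein_kernel_def)
  have "0 \<le> Inf ?S" using assms lower by (intro cInf_greatest) auto
  moreover have "Inf ?S \<le> stein_dist M \<phi> A"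
    using assms lower by (intro cInf_lower bdd_belowI[of _ 0]) auto
  ultimately show ?thesis
    unfolding free_stein_discrepancy_def by (intro power_mono)
qed

text \<open>The kernel is the class of the sequence \<open>[\<J>P\<^sub>k](X)\<close>, where \<open>(P\<^sub>k)\<close> represents the
  functional \<open>L\<close> for the form pulled back to \<open>\<P>\<^sup>n\<close> along \<open>P \<mapsto> [\<J>P](X)\<close>. Working on
  \<open>\<P>\<^sup>n\<close> avoids choosing preimages of Jacobians.\<close>

lemma free_stein_kernel_exists:
  fixes X :: "'h bop ^ 'n"
  assumes X: "\<And>i. X $ i \<in> M" "\<And>i. adj (X $ i) = X $ i"
    and centered: "\<And>i. \<phi> (nc_eval X (cyclic_deriv i V)) = 0"
  shows "\<exists>A. free_stein_kernel M \<phi> X V A \<and>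
    (stein_dist M \<phi> A)\<^sup>2 \<le> real CARD('n)
      + C_opt M \<phi> X * (ip_norm (vec_ip \<phi>) (vec_eval X (cyclic_grad V)))\<^sup>2
      - 2 * Re (vec_ip \<phi> (vec_eval X (cyclic_grad V)) X)"
proof -
  define D where "D = vec_eval X (cyclic_grad V)"
  define L where "L P = vec_ip \<phi> (vec_eval X P) D" for P
  define J where "J = jacobian_eval X"
  define C where "C = C_opt M \<phi> X"
  note mem = vec_eval_mem[OF X] and J_mem = jacobian_eval_mem[OF X]
  have D_mem: "D $ i \<in> M" for i unfolding D_def by (rule mem)
  have J_lin: "J P \<in> tensor_mats M" "J (P + Q) = J P + J Q" "J (c *\<^sub>C P) = c *\<^sub>C J P"
    "J (P - Q) = J P - J Q" for P Q c
    by (simp_all add: J_def J_mem jacobian_eval_add jacobian_eval_scaleC jacobian_eval_diff)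
  interpret P: psd_form UNIV "\<lambda>P Q. mat_ip M \<phi> (J P) (J Q)"
    by (rule psd_form_pullback[OF mat.psd_form_axioms]) (rule J_lin)+
  have P_N: "P.N P = mat.N (J P)" for P by (simp add: ip_norm_def)
  have vec_eval_lin: "vec_eval X (P + Q) = vec_eval X P + vec_eval X Q"
    "vec_eval X (c *\<^sub>C P) = c *\<^sub>C vec_eval X P" for P Q c
    by (simp_all add: vec_eval_def vec_eq_iff nc_eval_add nc_eval_scaleC)
  have L_add: "L (P + Q) = L P + L Q" and L_scaleC: "L (c *\<^sub>C P) = c * L P" for P Q c
    by (simp_all add: L_def vec_eval_lin vec.add_left vec.scaleC_left mem D_mem)
  have L_bound: "(cmod (L P))\<^sup>2 \<le> (C * (vec.N D)\<^sup>2) * (P.N P)\<^sup>2" for P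
  proof -
    \<comment> \<open>Centering \<open>P(X)\<close> does not change \<open>L P\<close>, as \<open>D\<close> is orthogonal to the constants.\<close>
    define Y where "Y = (\<chi> i. nc_eval X (P $ i) - \<phi> (nc_eval X (P $ i)) *\<^sub>C 1)"
    have Y_mem: "Y $ i \<in> M" for i
      by (simp add: Y_def alg.diff_mem M_closed nc_eval_mem[OF X])
    have "alg_ip \<phi> (Y $ i) (D $ i) = alg_ip \<phi> (vec_eval X P $ i) (D $ i)" for i
    proof -
      have "alg_ip \<phi> 1 (D $ i) = 0"
        using centered[of i] D_mem[of i]
        by (simp add: alg_ip_def phi_adj) (simp add: D_def vec_eval_def cyclic_grad_def)
      then show ?thesis
        using D_mem[of i]
        by (simp add: Y_def vec_eval_def alg.diff_left alg.scaleC_left M_closed nc_eval_mem[OF X])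
    qed
    then have "L P = vec_ip \<phi> Y D" by (simp add: L_def vec_ip_def)
    then have "cmod (L P) \<le> vec.N Y * vec.N D"
      using vec.cauchy_schwarz[of Y D] Y_mem D_mem by simp
    then have "(cmod (L P))\<^sup>2 \<le> (vec.N Y)\<^sup>2 * (vec.N D)\<^sup>2"
      unfolding power_mult_distrib[symmetric] by (rule power_mono) simp
    moreover have "(vec.N Y)\<^sup>2 \<le> C * (P.N P)\<^sup>2"
    proof -
      have "(vec.N Y)\<^sup>2 = (\<Sum>i\<in>UNIV. (alg.N (nc_eval X (P $ i) - \<phi> (nc_eval X (P $ i)) *\<^sub>C 1))\<^sup>2)"
        by (subst vec_norm_sq[OF Y_mem]) (simp add: Y_def)
      also have "\<dots> \<le> (\<Sum>i\<in>UNIV. C * (\<Sum>j\<in>UNIV. (ten.N (tensor_eval X (nc_deriv j (P $ i))))\<^sup>2))"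
        using free_poincare_C_opt[OF X] unfolding C_def free_poincare_def by (intro sum_mono) blast
      also have "\<dots> = C * (P.N P)\<^sup>2"
        unfolding P_N mat_norm_sq[OF J_lin(1)]
        by (simp add: sum_distrib_left J_def jacobian_eval_component)
      finally show ?thesis .
    qed
    ultimately show ?thesis
      using mult_right_mono[of "(vec.N Y)\<^sup>2" "C * (P.N P)\<^sup>2" "(vec.N D)\<^sup>2"] by (simp add: ac_simps)
  qed
  have K_nonneg: "0 \<le> C * (vec.N D)\<^sup>2"
    unfolding C_def using C_opt_nonneg[OF X] by simp
  obtain s r where s: "s \<in> cauchy_seqs UNIV (\<lambda>P Q. mat_ip M \<phi> (J P) (J Q))"
    and lim: "\<And>P. P \<in> UNIV \<Longrightarrow> (\<lambda>k. mat_ip M \<phi> (J P) (J (s k))) \<longlonglongrightarrow> L P"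
    and r: "(\<lambda>k. (P.N (s k))\<^sup>2) \<longlonglongrightarrow> r" "r \<le> C * (vec.N D)\<^sup>2"
    by (rule P.riesz_sequence[of L, OF L_add L_scaleC L_bound K_nonneg]) (rule that)
  define S where "S k = J (s k)" for k
  have S: "S \<in> cauchy_seqs (tensor_mats M) (mat_ip M \<phi>)"
    using s unfolding cauchy_seqs_def by (simp add: S_def J_lin P_N)
  have lim': "(\<lambda>k. mat_ip M \<phi> (S k) (J P)) \<longlonglongrightarrow> vec_ip \<phi> D (vec_eval X P)" for P
  proof -
    have "(\<lambda>k. cnj (mat_ip M \<phi> (J P) (S k))) \<longlonglongrightarrow> cnj (L P)"
      unfolding S_def by (intro tendsto_cnj lim) simp
    moreover have "cnj (mat_ip M \<phi> (J P) (S k)) = mat_ip M \<phi> (S k) (J P)" for k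
      unfolding S_def by (rule mat.hermitian[OF J_lin(1) J_lin(1), symmetric])
    moreover have "cnj (L P) = vec_ip \<phi> D (vec_eval X P)"
      unfolding L_def by (rule vec.hermitian[symmetric]) (simp_all add: mem D_mem)
    ultimately show ?thesis by simp
  qed
  have kernel: "free_stein_kernel M \<phi> X V (mat.cls S)"
    unfolding free_stein_kernel_def
  proof (intro conjI allI)
    show "mat.cls S \<in> L2_mats M \<phi>"
      unfolding L2_mats_def completion_def using S by (rule quotientI)
    fix P
    have "L2_ip M \<phi> (mat.cls S) (L2_embed M \<phi> (J P)) = vec_ip \<phi> D (vec_eval X P)"
      unfolding L2_ip_def L2_embed_def compl_embed_def
      by (rule mat.compl_ip_cls[OF S mat.cauchy_const[OF J_lin(1)] lim'])
    then show "vec_ip \<phi> (vec_eval X (cyclic_grad V)) (vec_eval X P)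
        = L2_ip M \<phi> (mat.cls S) (L2_embed M \<phi> (mat_eval X (jacobian P)))"
      by (simp add: D_def J_def jacobian_eval_def)
  qed
  have "(\<lambda>k. (mat.N (S k - mat (1 \<otimes> 1)))\<^sup>2) \<longlonglongrightarrow> r - 2 * Re (vec_ip \<phi> D X) + real CARD('n)"
  proof -
    have "(mat.N (S k - mat (1 \<otimes> 1)))\<^sup>2
        = (P.N (s k))\<^sup>2 - 2 * Re (mat_ip M \<phi> (S k) (mat (1 \<otimes> 1))) + real CARD('n)" for k
      by (simp add: mat.N_sq_diff[OF mat.cauchy_mem[OF S] mat_one_mem] mat_norm_one)
        (simp add: P_N S_def)
    moreover have "(\<lambda>k. mat_ip M \<phi> (S k) (mat (1 \<otimes> 1))) \<longlonglongrightarrow> vec_ip \<phi> D X"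
      using lim'[of "\<chi> i. nc_var i"] by (simp add: J_def jacobian_eval_vars vec_eval_vars)
    ultimately show ?thesis
      using r(1) by (simp only:) (intro tendsto_intros)
  qed
  then have "(stein_dist M \<phi> (mat.cls S))\<^sup>2 = r - 2 * Re (vec_ip \<phi> D X) + real CARD('n)"
    by (rule stein_dist_limit(1)[OF S])
  then show ?thesis
    using kernel r(2) unfolding C_def D_def by (intro exI[of _ "mat.cls S"]) simp
qed

end

section \<open>The quadratic potential\<close>

lemma tensor_mult_flip:
  fixes P Q :: "'n ncpoly" and y z :: "('n ncpoly, 'n ncpoly) tensor"
  shows "tensor_mult (tensor_flip (P \<otimes> Q)) = Q * P"
    and "tensor_mult (tensor_flip (y + z)) = tensor_mult (tensor_flip y) + tensor_mult (tensor_flip z)"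
    and "tensor_mult (tensor_flip (c *\<^sub>C z)) = c *\<^sub>C tensor_mult (tensor_flip z)"
proof -
  have flip: "cbilinear (\<lambda>a b :: 'n ncpoly. b \<otimes> (a :: 'n ncpoly))"
    by (simp add: cbilinear_def tens_linear)
  have mult: "cbilinear ((*) :: 'n ncpoly \<Rightarrow> 'n ncpoly \<Rightarrow> 'n ncpoly)"
    by (simp add: cbilinear_def distrib_left distrib_right nc_mult_scaleC)
  show "tensor_mult (tensor_flip (P \<otimes> Q)) = Q * P"
    "tensor_mult (tensor_flip (y + z)) = tensor_mult (tensor_flip y) + tensor_mult (tensor_flip z)"
    "tensor_mult (tensor_flip (c *\<^sub>C z)) = c *\<^sub>C tensor_mult (tensor_flip z)"
    by (simp_all add: tensor_flip_def tensor_mult_def tensor_lift_tens tensor_lift_add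
        tensor_lift_scaleC flip mult)
qed

lemma cyclic_deriv_add: "cyclic_deriv i (P + Q) = cyclic_deriv i P + cyclic_deriv i Q"
  and cyclic_deriv_scaleC: "cyclic_deriv i (c *\<^sub>C P) = c *\<^sub>C cyclic_deriv i P"
  by (simp_all add: cyclic_deriv_def nc_deriv_add nc_deriv_scaleC tensor_mult_flip)

lemma cyclic_deriv_square:
  fixes i j :: 'n
  shows "cyclic_deriv i (nc_var j * nc_var j) = (if i = j then 2 *\<^sub>C nc_var j else 0)"
proof -
  have "(2 :: complex) *\<^sub>C nc_var j = nc_var j + nc_var j"
    using scaleC_add_left[of 1 1 "nc_var j"] by (simp add: scaleC_one)
  moreover have "tensor_mult (tensor_flip (0 :: ('n ncpoly, 'n ncpoly) tensor)) = 0"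
    using tensor_mult_flip(3)[of 0 "0 :: ('n ncpoly, 'n ncpoly) tensor"] by simp
  ultimately show ?thesis
    by (simp add: cyclic_deriv_def nc_deriv_mult nc_deriv_var bimod_tens bimod_zero
        tensor_mult_flip)
qed

lemma cyclic_grad_quadratic:
  "cyclic_grad ((1/2) *\<^sub>C (\<Sum>i\<in>UNIV. nc_var i * nc_var i)) = (\<chi> i. nc_var (i :: 'n::finite))"
proof -
  have zero: "cyclic_deriv i 0 = 0" for i :: 'n using cyclic_deriv_scaleC[of i 0 0] by simp
  have "cyclic_deriv i (\<Sum>j\<in>A. f j) = (\<Sum>j\<in>A. cyclic_deriv i (f j))" for i A and f :: "'n \<Rightarrow> 'n ncpoly"
    by (induction A rule: infinite_finite_induct) (simp_all add: zero cyclic_deriv_add)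
  then show ?thesis
    by (simp add: cyclic_grad_def vec_eq_iff cyclic_deriv_scaleC cyclic_deriv_square scaleC_scaleC
        scaleC_one)
qed

theorem theorem3p3:
  fixes M :: "'h::chilbert_space bop set"
    and \<phi> :: "'h bop \<Rightarrow> complex"
    and X :: "'h bop ^ 'n"
    and V :: "'n ncpoly"
  assumes "von_neumann_algebra M"
    and "state_on M \<phi>" "faithful_on M \<phi>" "normal_on M \<phi>"
    and "\<And>i. X $ i \<in> M" "\<And>i. adj (X $ i) = X $ i"
  shows "((\<forall>i. \<phi> (nc_eval X (cyclic_deriv i V)) = 0) \<longrightarrow>
      (\<exists>A. free_stein_kernel M \<phi> X V A \<and>
        (free_stein_discrepancy M \<phi> X V)\<^sup>2 \<le> (stein_dist M \<phi> A)\<^sup>2 \<and>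
        (stein_dist M \<phi> A)\<^sup>2 \<le>
          real CARD('n) + C_opt M \<phi> X * (ip_norm (vec_ip \<phi>) (vec_eval X (cyclic_grad V)))\<^sup>2
          - 2 * Re (vec_ip \<phi> (vec_eval X (cyclic_grad V)) X)))
    \<and> ((\<forall>i. \<phi> (X $ i) = 0) \<and> (\<Sum>i\<in>UNIV. \<phi> (X $ i * X $ i)) = of_nat CARD('n) \<longrightarrow>
      (free_stein_discrepancy M \<phi> X ((1/2) *\<^sub>C (\<Sum>i\<in>UNIV. nc_var i * nc_var i)))\<^sup>2
        \<le> real CARD('n) * (C_opt M \<phi> X - 1))"
proof (intro conjI impI)
  interpret von_neumann_state M \<phi> by standard fact+
  note X = assms(5,6)
  show "\<exists>A. free_stein_kernel M \<phi> X V A \<and>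
        (free_stein_discrepancy M \<phi> X V)\<^sup>2 \<le> (stein_dist M \<phi> A)\<^sup>2 \<and>
        (stein_dist M \<phi> A)\<^sup>2 \<le>
          real CARD('n) + C_opt M \<phi> X * (ip_norm (vec_ip \<phi>) (vec_eval X (cyclic_grad V)))\<^sup>2
          - 2 * Re (vec_ip \<phi> (vec_eval X (cyclic_grad V)) X)"
    if "\<forall>i. \<phi> (nc_eval X (cyclic_deriv i V)) = 0"
    using free_stein_kernel_exists[OF X, of V] that free_stein_discrepancy_le by blast
  assume X0: "(\<forall>i. \<phi> (X $ i) = 0) \<and> (\<Sum>i\<in>UNIV. \<phi> (X $ i * X $ i)) = of_nat CARD('n)"
  define Q :: "'n ncpoly" where "Q = (1/2) *\<^sub>C (\<Sum>i\<in>UNIV. nc_var i * nc_var i)"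
  have grad: "cyclic_grad Q = (\<chi> i. nc_var i)"
    unfolding Q_def by (rule cyclic_grad_quadratic)
  have "cyclic_deriv i Q = nc_var i" for i
    using arg_cong[OF grad, of "\<lambda>v. v $ i"] by (simp add: cyclic_grad_def)
  then have "\<phi> (nc_eval X (cyclic_deriv i Q)) = 0" for i
    using X0 by (simp add: nc_eval_var)
  then obtain A where A: "free_stein_kernel M \<phi> X Q A"
    "(stein_dist M \<phi> A)\<^sup>2 \<le> real CARD('n) + C_opt M \<phi> X * (vec.N (vec_eval X (cyclic_grad Q)))\<^sup>2
          - 2 * Re (vec_ip \<phi> (vec_eval X (cyclic_grad Q)) X)"
    using free_stein_kernel_exists[OF X, of Q] by blast
  have ip: "vec_ip \<phi> X X = of_nat CARD('n)"
    using X0 X by (simp add: vec_ip_def alg_ip_def)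
  then have "(vec.N X)\<^sup>2 = real CARD('n)"
    by (simp add: ip_norm_def)
  with A(2) have "(stein_dist M \<phi> A)\<^sup>2 \<le> real CARD('n) * (C_opt M \<phi> X - 1)"
    by (simp add: grad vec_eval_vars ip algebra_simps)
  then show "(free_stein_discrepancy M \<phi> X ((1/2) *\<^sub>C (\<Sum>i\<in>UNIV. nc_var i * nc_var i)))\<^sup>2
        \<le> real CARD('n) * (C_opt M \<phi> X - 1)"
    using free_stein_discrepancy_le[OF A(1)] unfolding Q_def by linarith
qed

end
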